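(* Let $G$ be a complete multi-partite graph of order $n$ with at least two partite sets, and let $q$ be an integer with $(4n-2)/5\le q\le n-1$. Then $$ar(G,\mathcal{T}_q)=|E(G)|+1-|E_G(S_0)|$$ for any $S_0\in\mathcal{P}^*_{n-q+1}(G)$.
   Context: A $t$-edge-coloring of $G$ is a surjective map $E(G)\to\{1,\dots,t\}$; a subgraph is rainbow if its edges have pairwise distinct colors. $ar(G,\mathcal{C})$ is the maximum $t$ such that some $t$-edge-coloring of $G$ has no rainbow subgraph isomorphic to a member of $\mathcal{C}$ ($0$ if none). $\mathcal{T}_q$ is the set of trees with exactly $q$ edges. For $S\subseteq V(G)$, $E_G(S)$ is the set of edges incident with at least one vertex of $S$. $\mathcal{P}^*_r(G)$ is the family of all sets $S$ that can be output by the following greedy procedure (over all tie-breaking choices): start with $S=\emptyset$ and $G_1=G$; for $i=1,\dots,r$, choose a vertex $u$ of minimum degree in $G_i$, add $u$ to $S$, and set $G_{i+1}=G_i-u$. *)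

theory Defs
  imports Complex_Main "HOL-Library.Disjoint_Sets"
begin

record 'a ugraph =
  gverts :: "'a set"
  gedges :: "'a set set"

definition simple_ugraph :: "'a ugraph \<Rightarrow> bool" where
  "simple_ugraph G \<longleftrightarrow>
     finite (gverts G) \<and> (\<forall>e\<in>gedges G. e \<subseteq> gverts G \<and> card e = 2)"

definition sub_ugraph :: "'a ugraph \<Rightarrow> 'a ugraph \<Rightarrow> bool" where
  "sub_ugraph H G \<longleftrightarrow>
     simple_ugraph H \<and> gverts H \<subseteq> gverts G \<and> gedges H \<subseteq> gedges G"

definition ugraph_iso :: "'a ugraph \<Rightarrow> 'b ugraph \<Rightarrow> bool" where
  "ugraph_iso G H \<longleftrightarrow>
     (\<exists>f. bij_betw f (gverts G) (gverts H) \<and>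
          (\<forall>u\<in>gverts G. \<forall>v\<in>gverts G. {u, v} \<in> gedges G \<longleftrightarrow> {f u, f v} \<in> gedges H))"

definition ugraph_walk :: "'a ugraph \<Rightarrow> 'a list \<Rightarrow> bool" where
  "ugraph_walk G p \<longleftrightarrow>
     p \<noteq> [] \<and> set p \<subseteq> gverts G \<and> successively (\<lambda>u v. {u, v} \<in> gedges G) p"

definition connected_ugraph :: "'a ugraph \<Rightarrow> bool" where
  "connected_ugraph G \<longleftrightarrow> gverts G \<noteq> {} \<and>
     (\<forall>u\<in>gverts G. \<forall>v\<in>gverts G. \<exists>p. ugraph_walk G p \<and> hd p = u \<and> last p = v)"

text \<open>A cycle is given by the list of its vertices, without repeating the first one at the end.\<close>

definition ugraph_cycle :: "'a ugraph \<Rightarrow> 'a list \<Rightarrow> bool" where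
  "ugraph_cycle G p \<longleftrightarrow>
     length p \<ge> 3 \<and> distinct p \<and> ugraph_walk G p \<and> {last p, hd p} \<in> gedges G"

definition tree_ugraph :: "'a ugraph \<Rightarrow> bool" where
  "tree_ugraph T \<longleftrightarrow>
     simple_ugraph T \<and> connected_ugraph T \<and> (\<nexists>p. ugraph_cycle T p)"

text \<open>Trees are finite, so vertices of type \<^typ>\<open>nat\<close> provide a copy of every
  isomorphism type.\<close>

definition trees_with_edges :: "nat \<Rightarrow> nat ugraph set" where
  "trees_with_edges q = {T. tree_ugraph T \<and> card (gedges T) = q}"

definition complete_multipartite :: "'a ugraph \<Rightarrow> 'a set set \<Rightarrow> bool" where
  "complete_multipartite G P \<longleftrightarrow>
     simple_ugraph G \<and> partition_on (gverts G) P \<and>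
     gedges G = {{u, v} | u v. u \<in> gverts G \<and> v \<in> gverts G \<and> \<not> (\<exists>X\<in>P. u \<in> X \<and> v \<in> X)}"

definition edge_coloring :: "'a ugraph \<Rightarrow> nat \<Rightarrow> ('a set \<Rightarrow> nat) \<Rightarrow> bool" where
  "edge_coloring G t c \<longleftrightarrow> c ` gedges G = {1..t}"

definition rainbow :: "('a set \<Rightarrow> nat) \<Rightarrow> 'a ugraph \<Rightarrow> bool" where
  "rainbow c H \<longleftrightarrow> inj_on c (gedges H)"

definition anti_ramsey_colors :: "'a ugraph \<Rightarrow> 'b ugraph set \<Rightarrow> nat set" where
  "anti_ramsey_colors G C =
     {t. \<exists>c. edge_coloring G t c \<and>
             \<not> (\<exists>H. sub_ugraph H G \<and> rainbow c H \<and> (\<exists>F\<in>C. ugraph_iso H F))}"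

text \<open>For finite \<open>G\<close> the set of admissible numbers of colors is bounded by the number of edges.\<close>

definition ar :: "'a ugraph \<Rightarrow> 'b ugraph set \<Rightarrow> nat" where
  "ar G C =
     (if anti_ramsey_colors G C = {} then 0 else Max (anti_ramsey_colors G C))"

definition incident_edges :: "'a ugraph \<Rightarrow> 'a set \<Rightarrow> 'a set set" where
  "incident_edges G S = {e \<in> gedges G. \<exists>v\<in>S. v \<in> e}"

definition vdegree :: "'a ugraph \<Rightarrow> 'a \<Rightarrow> nat" where
  "vdegree G v = card {e \<in> gedges G. v \<in> e}"

definition delete_vertex :: "'a ugraph \<Rightarrow> 'a \<Rightarrow> 'a ugraph" where
  "delete_vertex G u = \<lparr>gverts = gverts G - {u}, gedges = {e \<in> gedges G. u \<notin> e}\<rparr>"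

text \<open>The recursion peels off the first vertex chosen by the greedy procedure; the comprehension
  ranges over all tie-breaking choices.\<close>

primrec greedy_min_degree_sets :: "nat \<Rightarrow> 'a ugraph \<Rightarrow> 'a set set" where
  "greedy_min_degree_sets 0 G = {{}}"
| "greedy_min_degree_sets (Suc r) G =
     {insert u S | u S. is_arg_min (vdegree G) (\<lambda>v. v \<in> gverts G) u \<and>
                        S \<in> greedy_min_degree_sets r (delete_vertex G u)}"

end

theory Submission imports Defs
begin

text \<open>
  Write \<open>r = n - q\<close>. For the upper bound, take a subgraph \<open>F\<close> with exactly one edge of each colour whose
  largest component \<open>A\<close> is as large as possible, so \<open>|A| \<le> q\<close>. Exchanging an edge leaving \<open>A\<close> for the edge of
  \<open>F\<close> of the same colour shows that the latter is a bridge of \<open>A\<close>; for a suitable such bridge, \<open>F\<close> minus the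
  bridge splits into blocks any two of which have together at most \<open>q\<close> vertices. It remains to see that
  such blocks span at most as many edges as the graph left by the greedy deletion of \<open>r + 1\<close> vertices,
  which is optimal among all vertex sets of size \<open>q - 1\<close>. Let \<open>X\<close> be the largest block and \<open>k = q - |X|\<close>. If
  \<open>k \<ge> r + 2\<close>, this holds because the average degree of complete multipartite graphs is superadditive under
  disjoint unions; if \<open>k \<le> r + 1\<close>, adding to \<open>X\<close> the \<open>k - 1\<close> other vertices with most neighbours in \<open>X\<close> suffices.
  The lower bound gives all edges meeting \<open>S\<^sub>0\<close> one common colour.
\<close>

section \<open>Complete multipartite graphs\<close>

text \<open>The summand 1 in the formula is the bridge: once it is removed, every remaining edge of
  \<open>F\<close> lies inside a block, so the block count bounds all colours but one. The obstacle
  in finding the bridge is that a swap bounds only the side holding the endpoint of the leaving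
  edge; the other side may still be too large to be paired with a component outside
  \<open>A\<close>. An extremal choice of the bridge, by the size of its larger side, repairs this.
  Two components outside \<open>A\<close> need no bridge: neither exceeds \<open>A\<close>, so
  together they hold at most two thirds of the n vertices. With n = q + r the hypothesis on q reads
  4 r \<le> q + 2. It gives 3 r \<le> q as soon as k \<ge> 2, so that \<open>X\<close> is large
  compared with the other blocks, which have at most k vertices. The threshold for k comes from the
  identity (q - r - 2) (q + r - 1) = (q - 1) (q - 2) - r (r + 1): blocks of at most q - r - 2
  vertices are small enough for the averaging argument.\<close>

definition medges :: "('a \<Rightarrow> 'b) \<Rightarrow> 'a set \<Rightarrow> 'a set set" where
  "medges \<pi> V = {{u, v} | u v. u \<in> V \<and> v \<in> V \<and> \<pi> u \<noteq> \<pi> v}"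

text \<open>Parts are given by the labelling \<open>\<pi>\<close>, so every vertex subset inherits
  its induced graph without a new partition. The vertex \<open>v\<close> may lie outside
  \<open>X\<close>, which lets the same function count edges from \<open>v\<close> into a disjoint
  set.\<close>

definition mdeg :: "('a \<Rightarrow> 'b) \<Rightarrow> 'a \<Rightarrow> 'a set \<Rightarrow> nat" where
  "mdeg \<pi> v X = card {x \<in> X. \<pi> x \<noteq> \<pi> v}"

abbreviation msize :: "('a \<Rightarrow> 'b) \<Rightarrow> 'a set \<Rightarrow> nat" where
  "msize \<pi> V \<equiv> card (medges \<pi> V)"

lemma doubleton_in_medges [simp]:
  "{u, v} \<in> medges \<pi> V \<longleftrightarrow> u \<in> V \<and> v \<in> V \<and> \<pi> u \<noteq> \<pi> v"
  unfolding medges_def by (auto simp: doubleton_eq_iff)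

lemma medgesE:
  assumes "e \<in> medges \<pi> V"
  obtains u v where "e = {u, v}" "u \<in> V" "v \<in> V" "\<pi> u \<noteq> \<pi> v"
  using assms unfolding medges_def by auto

lemma medges_subset: "e \<in> medges \<pi> V \<Longrightarrow> e \<subseteq> V"
  by (auto elim: medgesE)

lemma medges_mono: "X \<subseteq> Y \<Longrightarrow> medges \<pi> X \<subseteq> medges \<pi> Y"
  unfolding medges_def by blast

lemma finite_medges [simp]: "finite V \<Longrightarrow> finite (medges \<pi> V)"
  by (rule finite_subset[of _ "Pow V"]) (auto dest: medges_subset)

lemma medges_empty [simp]: "medges \<pi> {} = {}"
  by (simp add: medges_def)

lemma mdeg_le: "finite X \<Longrightarrow> mdeg \<pi> v X \<le> card X"
  unfolding mdeg_def by (rule card_mono) auto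

lemma mdeg_less: "finite X \<Longrightarrow> v \<in> X \<Longrightarrow> mdeg \<pi> v X < card X"
  unfolding mdeg_def by (rule psubset_card_mono) auto

lemma mdeg_Un:
  assumes "finite X" "finite Y" "X \<inter> Y = {}"
  shows "mdeg \<pi> v (X \<union> Y) = mdeg \<pi> v X + mdeg \<pi> v Y"
proof -
  have "{x \<in> X \<union> Y. \<pi> x \<noteq> \<pi> v} = {x \<in> X. \<pi> x \<noteq> \<pi> v} \<union> {x \<in> Y. \<pi> x \<noteq> \<pi> v}"
    by auto
  then show ?thesis
    unfolding mdeg_def using assms by (simp add: card_Un_disjoint disjoint_iff)
qed

lemma card_medges_at:
  assumes "finite V" "v \<in> V"
  shows "card {e \<in> medges \<pi> V. v \<in> e} = mdeg \<pi> v V"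
proof -
  have "{e \<in> medges \<pi> V. v \<in> e} = (\<lambda>x. {v, x}) ` {x \<in> V. \<pi> x \<noteq> \<pi> v}"
    using assms(2) by (auto elim!: medgesE simp: image_iff)
  moreover have "inj_on (\<lambda>x. {v, x}) {x \<in> V. \<pi> x \<noteq> \<pi> v}"
    by (auto simp: inj_on_def doubleton_eq_iff)
  ultimately show ?thesis
    unfolding mdeg_def by (simp add: card_image)
qed

lemma medges_Diff: "medges \<pi> (V - S) = {e \<in> medges \<pi> V. e \<inter> S = {}}"
  by (auto simp: medges_def)

lemma msize_remove:
  assumes "finite V" "v \<in> V"
  shows "msize \<pi> V = msize \<pi> (V - {v}) + mdeg \<pi> v V"
proof -
  have "medges \<pi> V = medges \<pi> (V - {v}) \<union> {e \<in> medges \<pi> V. v \<in> e}"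
    by (auto simp: medges_Diff)
  moreover have "medges \<pi> (V - {v}) \<inter> {e \<in> medges \<pi> V. v \<in> e} = {}"
    by (auto simp: medges_Diff)
  ultimately show ?thesis
    using assms card_medges_at[OF assms, of \<pi>]
    by (metis (no_types, lifting) card_Un_disjoint finite_Un finite_medges)
qed

lemma msize_insert:
  assumes "finite V" "v \<notin> V"
  shows "msize \<pi> (insert v V) = msize \<pi> V + mdeg \<pi> v V"
proof -
  have "mdeg \<pi> v (insert v V) = mdeg \<pi> v V"
    unfolding mdeg_def by (rule arg_cong[where f = card]) auto
  then show ?thesis
    using msize_remove[of "insert v V" v \<pi>] assms by simp
qed

lemma msize_Un:
  assumes "finite X" "finite Y" "X \<inter> Y = {}"
  shows "msize \<pi> (X \<union> Y) = msize \<pi> X + msize \<pi> Y + (\<Sum>y\<in>Y. mdeg \<pi> y X)"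
  using assms(2,3)
proof (induction Y rule: finite_induct)
  case (insert y Y)
  have "msize \<pi> (X \<union> insert y Y) = msize \<pi> (X \<union> Y) + mdeg \<pi> y (X \<union> Y)"
    using insert msize_insert[of "X \<union> Y" y \<pi>] assms(1) by simp
  also have "mdeg \<pi> y (X \<union> Y) = mdeg \<pi> y X + mdeg \<pi> y Y"
    using insert assms(1) by (intro mdeg_Un) auto
  finally show ?case
    using insert by (simp add: msize_insert)
qed simp

lemma sum_mdeg_insert:
  assumes "finite V" "v \<notin> V"
  shows "(\<Sum>x\<in>V. mdeg \<pi> x (insert v V)) = (\<Sum>x\<in>V. mdeg \<pi> x V) + mdeg \<pi> v V"
proof -
  have "mdeg \<pi> x (insert v V) = mdeg \<pi> x V + (if \<pi> x \<noteq> \<pi> v then 1 else 0)" for x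
    using mdeg_Un[of V "{v}" \<pi> x] assms
    by (auto simp: mdeg_def Collect_conv_if card_insert_if)
  then have "(\<Sum>x\<in>V. mdeg \<pi> x (insert v V))
      = (\<Sum>x\<in>V. mdeg \<pi> x V) + (\<Sum>x\<in>V. if \<pi> x \<noteq> \<pi> v then 1 else 0)"
    by (simp add: sum.distrib)
  also have "(\<Sum>x\<in>V. if \<pi> x \<noteq> \<pi> v then 1 else 0) = mdeg \<pi> v V"
    unfolding mdeg_def using assms by (simp add: sum.If_cases Int_def)
  finally show ?thesis .
qed

lemma sum_mdeg:
  assumes "finite V"
  shows "(\<Sum>v\<in>V. mdeg \<pi> v V) = 2 * msize \<pi> V"
  using assms
proof (induction V rule: finite_induct)
  case (insert v V)
  have "mdeg \<pi> v (insert v V) = mdeg \<pi> v V"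
    unfolding mdeg_def by (rule arg_cong[where f = card]) auto
  then show ?case
    using insert by (simp add: sum_mdeg_insert msize_insert)
qed simp

text \<open>Since \<open>B - J\<close> lies in a single part it spans no edge, so
  \<open>B \<inter> J\<close> is a vertex cover of the graph on \<open>B\<close>; its degrees count
  every edge at least once.\<close>

lemma msize_le_cover:
  assumes "finite B" "\<And>u v. u \<in> B - J \<Longrightarrow> v \<in> B - J \<Longrightarrow> \<pi> u = \<pi> v"
  shows "msize \<pi> B \<le> (\<Sum>u\<in>B \<inter> J. mdeg \<pi> u B)"
proof -
  have "medges \<pi> (B - J) = {}"
    using assms(2) by (auto elim!: medgesE)
  then have "msize \<pi> B = msize \<pi> (B \<inter> J) + (\<Sum>u\<in>B \<inter> J. mdeg \<pi> u (B - J))"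
    using msize_Un[of "B - J" "B \<inter> J" \<pi>] assms(1)
    by (simp add: Diff_Int_distrib2 Un_Diff_Int disjoint_iff)
  also have "msize \<pi> (B \<inter> J) \<le> (\<Sum>u\<in>B \<inter> J. mdeg \<pi> u (B \<inter> J))"
    using sum_mdeg[of "B \<inter> J" \<pi>] assms(1) by simp
  also have "(\<Sum>u\<in>B \<inter> J. mdeg \<pi> u (B \<inter> J)) + (\<Sum>u\<in>B \<inter> J. mdeg \<pi> u (B - J))
      = (\<Sum>u\<in>B \<inter> J. mdeg \<pi> u B)"
    unfolding sum.distrib[symmetric]
    using mdeg_Un[of "B \<inter> J" "B - J" \<pi>] assms(1) by (intro sum.cong) (simp_all add: Int_Diff_Un disjoint_iff)
  finally show ?thesis by simp
qed

lemma msize_le: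
  assumes "finite B"
  shows "2 * msize \<pi> B \<le> card B * (card B - 1)"
proof -
  have "(\<Sum>v\<in>B. mdeg \<pi> v B) \<le> (\<Sum>v\<in>B. card B - 1)"
    using mdeg_less[OF assms, of _ \<pi>] by (intro sum_mono) (metis One_nat_def Suc_pred less_Suc_eq_le not_less_zero neq0_conv)
  then show ?thesis
    by (simp add: sum_mdeg[OF assms])
qed

text \<open>The non-edges between \<open>X\<close> and \<open>Y\<close> number \<open>\<Sum>\<^sub>p x\<^sub>p y\<^sub>p\<close>, where \<open>x\<^sub>p\<close> and \<open>y\<^sub>p\<close> count the
  vertices in part \<open>p\<close>; so Cauchy-Schwarz in the weighted form \<open>2 s t x y \<le> t\<^sup>2 x\<^sup>2 + s\<^sup>2 y\<^sup>2\<close> applies.\<close>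

lemma cross_edges_ge:
  assumes X: "finite X" and Y: "finite Y"
  shows "(card Y)\<^sup>2 * msize \<pi> X + (card X)\<^sup>2 * msize \<pi> Y
    \<le> card X * card Y * (\<Sum>y\<in>Y. mdeg \<pi> y X)"
proof -
  define I where "I = \<pi> ` (X \<union> Y)"
  define c where "c Z p = int (card {z \<in> Z. \<pi> z = p})" for Z p
  have I: "finite I" unfolding I_def using X Y by simp
  have deg: "int (mdeg \<pi> y Z) = int (card Z) - c Z (\<pi> y)" if "finite Z" for y Z
  proof -
    have "card Z = card {z \<in> Z. \<pi> z = \<pi> y} + card {z \<in> Z. \<pi> z \<noteq> \<pi> y}"
      using that by (subst card_Un_disjoint[symmetric]) (auto intro: arg_cong[where f = card])
    then show ?thesis unfolding mdeg_def c_def by simp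
  qed
  have sum_c: "(\<Sum>y\<in>Z. c Z' (\<pi> y)) = (\<Sum>p\<in>I. c Z p * c Z' p)"
    if "finite Z" "Z \<subseteq> X \<union> Y" for Z Z'
  proof -
    have "(\<Sum>y\<in>Z. c Z' (\<pi> y)) = (\<Sum>p\<in>I. \<Sum>y | y \<in> Z \<and> \<pi> y = p. c Z' (\<pi> y))"
      using that I by (intro sum.group[symmetric]) (auto simp: I_def)
    also have "\<dots> = (\<Sum>p\<in>I. c Z p * c Z' p)"
      by (intro sum.cong) (auto simp: c_def)
    finally show ?thesis .
  qed
  \<comment> \<open>Also applied with \<open>Z = Z'\<close>, where the left side is twice the number
    of edges in \<open>Z\<close>.\<close>
  have pair: "int (\<Sum>y\<in>Z. mdeg \<pi> y Z') = int (card Z) * int (card Z') - (\<Sum>p\<in>I. c Z p * c Z' p)"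
    if "finite Z" "finite Z'" "Z \<subseteq> X \<union> Y" for Z Z'
    using that by (simp add: deg sum_subtractf sum_c)
  let ?s = "int (card X)" and ?t = "int (card Y)"
  have "(\<Sum>p\<in>I. 2 * (?s * ?t) * (c Y p * c X p))
      \<le> (\<Sum>p\<in>I. ?t\<^sup>2 * (c X p * c X p) + ?s\<^sup>2 * (c Y p * c Y p))"
  proof (rule sum_mono)
    fix p
    have "0 \<le> (?t * c X p - ?s * c Y p)\<^sup>2" by simp
    then show "2 * (?s * ?t) * (c Y p * c X p) \<le> ?t\<^sup>2 * (c X p * c X p) + ?s\<^sup>2 * (c Y p * c Y p)"
      by (simp add: power2_eq_square algebra_simps)
  qed
  then have *: "2 * (?s * ?t) * (\<Sum>p\<in>I. c Y p * c X p)
      \<le> ?t\<^sup>2 * (\<Sum>p\<in>I. c X p * c X p) + ?s\<^sup>2 * (\<Sum>p\<in>I. c Y p * c Y p)"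
    by (simp add: sum_distrib_left sum.distrib)
  have XX: "2 * int (msize \<pi> X) = ?s * ?s - (\<Sum>p\<in>I. c X p * c X p)"
    using pair[OF X X] sum_mdeg[OF X, of \<pi>] by simp
  have YY: "2 * int (msize \<pi> Y) = ?t * ?t - (\<Sum>p\<in>I. c Y p * c Y p)"
    using pair[OF Y Y] sum_mdeg[OF Y, of \<pi>] by simp
  have YX: "int (\<Sum>y\<in>Y. mdeg \<pi> y X) = ?t * ?s - (\<Sum>p\<in>I. c Y p * c X p)"
    using pair[OF Y X] by simp
  have "2 * (?t\<^sup>2 * int (msize \<pi> X) + ?s\<^sup>2 * int (msize \<pi> Y))
      = ?t\<^sup>2 * (2 * int (msize \<pi> X)) + ?s\<^sup>2 * (2 * int (msize \<pi> Y))"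
    by (simp add: algebra_simps)
  also have "\<dots> \<le> 2 * (?s * ?t * int (\<Sum>y\<in>Y. mdeg \<pi> y X))"
    unfolding XX YY YX using * by (simp add: algebra_simps power2_eq_square)
  finally have "?t\<^sup>2 * int (msize \<pi> X) + ?s\<^sup>2 * int (msize \<pi> Y) \<le> ?s * ?t * int (\<Sum>y\<in>Y. mdeg \<pi> y X)"
    by simp
  then show ?thesis
    unfolding of_nat_power[symmetric] of_nat_mult[symmetric] of_nat_add[symmetric] of_nat_le_iff .
qed

text \<open>Division by zero makes the value 0 on the empty set, so superadditivity holds without a
  nonemptiness condition.\<close>

definition half_avg_deg :: "('a \<Rightarrow> 'b) \<Rightarrow> 'a set \<Rightarrow> real" where
  "half_avg_deg \<pi> X = msize \<pi> X / card X"

text \<open>Multiplying the left side by s + t gives the edges inside \<open>X\<close> and inside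
  \<open>Y\<close> plus (t/s) e(X) + (s/t) e(Y), and the latter is exactly the lower bound on the
  edges between them from \<open>cross_edges_ge\<close>.\<close>

lemma half_avg_deg_Un:
  assumes "finite X" "finite Y" "X \<inter> Y = {}"
  shows "half_avg_deg \<pi> X + half_avg_deg \<pi> Y \<le> half_avg_deg \<pi> (X \<union> Y)"
proof (cases "X = {} \<or> Y = {}")
  case False
  let ?s = "real (card X)" and ?t = "real (card Y)" and ?a = "real (msize \<pi> X)"
    and ?b = "real (msize \<pi> Y)" and ?c = "real (\<Sum>y\<in>Y. mdeg \<pi> y X)"
  have pos: "?s > 0" "?t > 0" using False assms by auto
  have "real ((card Y)\<^sup>2 * msize \<pi> X + (card X)\<^sup>2 * msize \<pi> Y) 
      \<le> real (card X * card Y * (\<Sum>y\<in>Y. mdeg \<pi> y X))"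
    using cross_edges_ge[OF assms(1,2), of \<pi>] by (intro of_nat_mono)
  then have le: "?t\<^sup>2 * ?a + ?s\<^sup>2 * ?b \<le> ?s * ?t * ?c" 
    unfolding of_nat_power of_nat_mult of_nat_add .
  have "(?a / ?s + ?b / ?t) * (?s + ?t) = ?a + ?b + (?t\<^sup>2 * ?a + ?s\<^sup>2 * ?b) / (?s * ?t)"
    using pos by (simp add: field_simps power2_eq_square)
  also have "\<dots> \<le> ?a + ?b + ?c"
    using le pos by (simp add: field_simps)
  finally have "?a / ?s + ?b / ?t \<le> (?a + ?b + ?c) / (?s + ?t)"
    using pos by (simp add: field_simps)
  then show ?thesis
    unfolding half_avg_deg_def using assms
    by (simp add: msize_Un card_Un_disjoint)
qed (auto simp: half_avg_deg_def)

lemma half_avg_deg_Union: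
  assumes "finite \<B>" "disjoint \<B>" "\<And>B. B \<in> \<B> \<Longrightarrow> finite B"
  shows "(\<Sum>B\<in>\<B>. half_avg_deg \<pi> B) \<le> half_avg_deg \<pi> (\<Union>\<B>)"
  using assms
proof (induction \<B> rule: finite_induct)
  case (insert B \<B>)
  have "(\<Sum>B\<in>insert B \<B>. half_avg_deg \<pi> B) \<le> half_avg_deg \<pi> B + half_avg_deg \<pi> (\<Union>\<B>)"
    using insert by (auto intro: pairwise_subset)
  also have "\<dots> \<le> half_avg_deg \<pi> (B \<union> \<Union>\<B>)"
    using insert by (intro half_avg_deg_Un) (auto simp: disjoint_def)
  finally show ?case by simp
qed (simp add: half_avg_deg_def)

section \<open>Greedy deletion of minimum-degree vertices\<close>

definition mgraph :: "('a \<Rightarrow> 'b) \<Rightarrow> 'a set \<Rightarrow> 'a ugraph" where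
  "mgraph \<pi> V = \<lparr>gverts = V, gedges = medges \<pi> V\<rparr>"

lemma gverts_mgraph [simp]: "gverts (mgraph \<pi> V) = V"
  and gedges_mgraph [simp]: "gedges (mgraph \<pi> V) = medges \<pi> V"
  by (simp_all add: mgraph_def)

lemma delete_vertex_mgraph: "delete_vertex (mgraph \<pi> V) u = mgraph \<pi> (V - {u})"
  by (simp add: delete_vertex_def mgraph_def medges_Diff)

lemma vdegree_mgraph: "finite V \<Longrightarrow> v \<in> V \<Longrightarrow> vdegree (mgraph \<pi> V) v = mdeg \<pi> v V"
  by (simp add: vdegree_def card_medges_at)

lemma greedy_mgraph_SucE:
  assumes "S \<in> greedy_min_degree_sets (Suc r) (mgraph \<pi> V)" "finite V"
  obtains u S' where "S = insert u S'" "u \<in> V" "\<forall>v\<in>V. mdeg \<pi> u V \<le> mdeg \<pi> v V"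
    "S' \<in> greedy_min_degree_sets r (mgraph \<pi> (V - {u}))"
proof -
  obtain u S' where "S = insert u S'" "is_arg_min (vdegree (mgraph \<pi> V)) (\<lambda>v. v \<in> V) u"
    "S' \<in> greedy_min_degree_sets r (mgraph \<pi> (V - {u}))"
    using assms(1) by (auto simp: delete_vertex_mgraph)
  then show thesis
    using that[of u S'] by (auto simp: is_arg_min_linorder vdegree_mgraph[OF assms(2)])
qed

lemma greedy_mgraph_subset:
  assumes "S \<in> greedy_min_degree_sets r (mgraph \<pi> V)" "finite V"
  shows "S \<subseteq> V \<and> card S = r"
  using assms
proof (induction r arbitrary: V S)
  case (Suc r)
  from Suc.prems obtain u S' where *: "S = insert u S'" "u \<in> V"
    "S' \<in> greedy_min_degree_sets r (mgraph \<pi> (V - {u}))"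
    by (elim greedy_mgraph_SucE)
  then have S': "S' \<subseteq> V - {u}" "card S' = r"
    using Suc.IH[OF *(3)] Suc.prems(2) by auto
  moreover have "finite S'"
    using S'(1) Suc.prems(2) by (meson finite_Diff finite_subset)
  ultimately show ?case
    using * by (auto simp: card_insert_if)
qed simp

text \<open>Passing from \<open>V\<close> to \<open>W\<close> costs \<open>u\<close> all of
  \<open>V - W\<close>, the largest loss any vertex can suffer, so \<open>u\<close> stays below
  \<open>v\<close>.\<close>

lemma mdeg_subset_le:
  assumes "finite V" "u \<in> W" "v \<in> W" "W \<subseteq> V" "mdeg \<pi> u V \<le> mdeg \<pi> v V"
    and "\<And>x. x \<in> V - W \<Longrightarrow> \<pi> x \<noteq> \<pi> u"
  shows "mdeg \<pi> u W \<le> mdeg \<pi> v W"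
proof -
  have fin: "finite W" "finite (V - W)" and V: "V = W \<union> (V - W)"
    using assms by (auto intro: finite_subset)
  have "mdeg \<pi> u (V - W) = card (V - W)"
    unfolding mdeg_def using assms(6) by (intro arg_cong[where f = card]) auto
  moreover have "mdeg \<pi> v (V - W) \<le> card (V - W)"
    using fin by (intro mdeg_le)
  moreover have "mdeg \<pi> x V = mdeg \<pi> x W + mdeg \<pi> x (V - W)" for x
    using mdeg_Un[of W "V - W" \<pi> x] fin V by simp
  ultimately show ?thesis
    using assms(5) by simp
qed

text \<open>If \<open>S\<close> contains a vertex with the label of \<open>u\<close>, the two have
  the same neighbours and can be interchanged. Otherwise \<open>S\<close> avoids the part of
  \<open>u\<close>, so deleting \<open>S - {v}\<close> hits \<open>u\<close> as hard as possible;
  \<open>u\<close> still has degree at most that of \<open>v\<close> in the rest, and deleting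
  \<open>u\<close> in place of \<open>v\<close> loses no more edges.\<close>

lemma msize_exchange:
  assumes "finite V" "u \<in> V" "\<forall>v\<in>V. mdeg \<pi> u V \<le> mdeg \<pi> v V"
    and "S \<subseteq> V" "S \<noteq> {}" "u \<notin> S"
  obtains v where "v \<in> S" "msize \<pi> (V - S) \<le> msize \<pi> (V - insert u (S - {v}))"
proof -
  have main: "msize \<pi> (V - S) \<le> msize \<pi> (V - insert u (S - {v}))"
    if "v \<in> S" "mdeg \<pi> u (V - (S - {v})) \<le> mdeg \<pi> v (V - (S - {v}))" for v
  proof -
    have "V - (S - {v}) - {v} = V - S" "V - (S - {v}) - {u} = V - insert u (S - {v})"
      using that(1) by auto
    moreover have "finite (V - (S - {v}))" "u \<in> V - (S - {v})" "v \<in> V - (S - {v})"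
      using assms(1,2,4,6) that(1) by auto
    ultimately show ?thesis
      using msize_remove[of "V - (S - {v})" u \<pi>] msize_remove[of "V - (S - {v})" v \<pi>] that(2)
      by simp
  qed
  show thesis
  proof (cases "\<exists>v\<in>S. \<pi> v = \<pi> u")
    case True
    then obtain v where "v \<in> S" "\<pi> v = \<pi> u" by blast
    then show ?thesis using main[of v] that[of v] by (simp add: mdeg_def)
  next
    case False
    obtain v where v: "v \<in> S" using assms by blast
    have "mdeg \<pi> u (V - (S - {v})) \<le> mdeg \<pi> v (V - (S - {v}))"
      by (rule mdeg_subset_le[of V]) (use assms v False in auto)
    then show ?thesis using main[OF v] that[OF v] by blast
  qed
qed

text \<open>By exchange, any competitor may be assumed to contain the first greedy vertex; the
  comparison then takes place after deleting it. The argument works for every tie-breaking, which is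
  why the final formula does not depend on the choice of \<open>S\<^sub>0\<close>.\<close>

lemma greedy_optimal:
  assumes "S\<^sub>0 \<in> greedy_min_degree_sets r (mgraph \<pi> V)" "finite V" "S \<subseteq> V" "card S = r"
  shows "msize \<pi> (V - S) \<le> msize \<pi> (V - S\<^sub>0)"
  using assms
proof (induction r arbitrary: V S S\<^sub>0)
  case 0
  then show ?case by (metis card_0_eq finite_subset greedy_mgraph_subset le_refl)
next
  case (Suc r)
  from Suc.prems obtain u S' where *: "S\<^sub>0 = insert u S'" "u \<in> V"
    "\<forall>v\<in>V. mdeg \<pi> u V \<le> mdeg \<pi> v V"
    "S' \<in> greedy_min_degree_sets r (mgraph \<pi> (V - {u}))"
    by (elim greedy_mgraph_SucE) blast
  have IH: "msize \<pi> (V - T) \<le> msize \<pi> (V - S\<^sub>0)" if "T \<subseteq> V" "card T = Suc r" "u \<in> T" for T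
  proof -
    have "finite T" using that Suc.prems finite_subset by blast
    then have "msize \<pi> (V - {u} - (T - {u})) \<le> msize \<pi> (V - {u} - S')"
      using that Suc.prems by (intro Suc.IH *(4)) auto
    moreover have "V - {u} - (T - {u}) = V - T" "V - {u} - S' = V - S\<^sub>0"
      using that * by auto
    ultimately show ?thesis by simp
  qed
  show ?case
  proof (cases "u \<in> S")
    case False
    have "S \<noteq> {}" using Suc.prems by auto
    then obtain v where v: "v \<in> S" "msize \<pi> (V - S) \<le> msize \<pi> (V - insert u (S - {v}))"
      using msize_exchange[of V u \<pi> S] Suc.prems * False by metis
    have "finite S" using Suc.prems finite_subset by blast
    then have "card (insert u (S - {v})) = Suc r"
      using v False Suc.prems by (simp add: card_insert_if)
    then have "msize \<pi> (V - insert u (S - {v})) \<le> msize \<pi> (V - S\<^sub>0)"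
      using Suc.prems * by (intro IH) auto
    then show ?thesis using v by simp
  qed (use IH Suc.prems in auto)
qed

text \<open>The density, edges per pair of vertices, does not drop when a vertex of minimum degree
  is deleted, because the minimum degree is at most the average 2 e / n. The inequality is cleared
  of denominators.\<close>

lemma greedy_average:
  assumes "S \<in> greedy_min_degree_sets r (mgraph \<pi> V)" "finite V"
  shows "msize \<pi> V * ((card V - r) * (card V - r - 1))
    \<le> msize \<pi> (V - S) * (card V * (card V - 1))"
  using assms
proof (induction r arbitrary: V S)
  case (Suc r)
  from Suc.prems obtain u S' where *: "S = insert u S'" "u \<in> V"
    "\<forall>v\<in>V. mdeg \<pi> u V \<le> mdeg \<pi> v V"
    "S' \<in> greedy_min_degree_sets r (mgraph \<pi> (V - {u}))"
    by (elim greedy_mgraph_SucE) blast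
  obtain m where m: "card V = Suc m"
    using *(2) Suc.prems(2) by (metis card_Suc_Diff1)
  have VS: "V - S = V - {u} - S'" using *(1) by auto
  have "card V * mdeg \<pi> u V \<le> (\<Sum>v\<in>V. mdeg \<pi> v V)"
    using *(3) sum_mono[of V "\<lambda>_. mdeg \<pi> u V"] by simp
  also have "\<dots> = 2 * msize \<pi> V" by (rule sum_mdeg[OF Suc.prems(2)])
  finally have "card V * msize \<pi> V \<le> card V * msize \<pi> (V - {u}) + 2 * msize \<pi> V"
    using msize_remove[OF Suc.prems(2) *(2), of \<pi>] by (simp add: algebra_simps)
  then have step: "(m - 1) * msize \<pi> V \<le> Suc m * msize \<pi> (V - {u})"
    by (cases m) (simp_all add: m)
  have IH: "msize \<pi> (V - {u}) * ((m - r) * (m - r - 1)) \<le> msize \<pi> (V - S) * (m * (m - 1))"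
    using Suc.IH[OF *(4)] Suc.prems(2) *(2) m VS by simp
  have "(m - 1) * (msize \<pi> V * ((m - r) * (m - r - 1)))
      \<le> Suc m * (msize \<pi> (V - {u}) * ((m - r) * (m - r - 1)))"
    using mult_right_mono[OF step, of "(m - r) * (m - r - 1)"] by (simp only: ac_simps)
  also have "\<dots> \<le> Suc m * (msize \<pi> (V - S) * (m * (m - 1)))"
    by (rule mult_left_mono[OF IH]) simp
  finally have "(m - 1) * (msize \<pi> V * ((m - r) * (m - r - 1)))
      \<le> (m - 1) * (msize \<pi> (V - S) * (Suc m * m))"
    by (simp only: ac_simps)
  \<comment> \<open>Cancelling m - 1 fails only for m \<le> 1, and then the factor (m - r) (m - r -
    1) on the left vanishes.\<close>
  then show ?case
    by (cases "m - 1 = 0") (auto simp: m)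
qed simp

section \<open>Edges inside the blocks of a partition\<close>

text \<open>A block has |B| h(B) edges, with h half the average degree. Replacing |B| by its bound
  (q - 1) (q - 2) / (n - 1) and using that the h(B) sum to at most h(V) = e(V) / n gives e(V) (q -
  1) (q - 2) / (n (n - 1)). This is the number of edges that the density of the whole graph predicts
  for q - 1 vertices, and greedy deletion keeps at least that many.\<close>

lemma sum_msize_le_average:
  fixes \<pi> :: "'a \<Rightarrow> 'b"
  assumes V: "finite V" "card V = q + r" "partition_on V \<B>"
    and le: "\<And>B. B \<in> \<B> \<Longrightarrow> card B * (q + r - 1) \<le> (q - 1) * (q - 2)"
    and S: "S \<in> greedy_min_degree_sets (Suc r) (mgraph \<pi> V)" and n: "q + r \<ge> 2"
  shows "(\<Sum>B\<in>\<B>. msize \<pi> B) \<le> msize \<pi> (V - S)"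
proof -
  have fB: "finite \<B>" using V finite_elements by metis
  have fin: "finite B" if "B \<in> \<B>" for B
    using that V by (metis Union_upper finite_subset partition_onD1)
  let ?h = "half_avg_deg \<pi>" and ?M = "real ((q - 1) * (q - 2))"
  have msize: "real (msize \<pi> B) = card B * ?h B" if "finite B" for B
    using that by (cases "B = {}") (auto simp: half_avg_deg_def)
  have "real (q + r - 1) * (\<Sum>B\<in>\<B>. msize \<pi> B) = (\<Sum>B\<in>\<B>. real (card B * (q + r - 1)) * ?h B)"
    unfolding of_nat_sum sum_distrib_left by (intro sum.cong) (use msize fin in auto)
  also have "\<dots> \<le> (\<Sum>B\<in>\<B>. ?M * ?h B)"
    by (intro sum_mono mult_right_mono) (use le in \<open>auto simp: half_avg_deg_def simp flip: of_nat_mult\<close>)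
  also have "\<dots> = ?M * (\<Sum>B\<in>\<B>. ?h B)"
    by (simp add: sum_distrib_left)
  also have "\<dots> \<le> ?M * ?h V"
    using half_avg_deg_Union[of \<B> \<pi>] fB fin V(3)
    by (intro mult_left_mono) (auto simp: partition_on_def)
  finally have 1: "real (q + r) * (real (q + r - 1) * (\<Sum>B\<in>\<B>. msize \<pi> B)) \<le> real (q + r) * (?M * ?h V)"
    by (intro mult_left_mono) auto
  have "real (q + r) * (?M * ?h V) = real (msize \<pi> V * ((q - 1) * (q - 2)))"
    using msize[OF V(1)] V(2) by simp
  also have "\<dots> \<le> real (msize \<pi> (V - S) * ((q + r) * (q + r - 1)))"
    using greedy_average[OF S V(1)] V(2)
    by (intro of_nat_mono) (simp add: numeral_2_eq_2 diff_diff_left add.commute)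
  finally have "real (q + r) * (real (q + r - 1) * (\<Sum>B\<in>\<B>. msize \<pi> B))
      \<le> real (q + r) * (real (q + r - 1) * msize \<pi> (V - S))"
    using 1 by (simp only: of_nat_mult ac_simps)
  then have "(q + r) * ((q + r - 1) * (\<Sum>B\<in>\<B>. msize \<pi> B)) \<le> (q + r) * ((q + r - 1) * msize \<pi> (V - S))"
    unfolding of_nat_mult[symmetric] of_nat_le_iff .
  then show ?thesis
    using n unfolding mult_le_cancel1 by linarith
qed

text \<open>Two vertices with different labels have no common non-neighbour, so their degrees into
  \<open>X\<close> add up to at least |X|.\<close>

lemma low_degree_same_part:
  assumes "finite X" "2 * mdeg \<pi> u X < card X" "2 * mdeg \<pi> v X < card X"
  shows "\<pi> u = \<pi> v"
proof (rule ccontr)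
  assume "\<pi> u \<noteq> \<pi> v"
  then have "X = {x \<in> X. \<pi> x \<noteq> \<pi> u} \<union> {x \<in> X. \<pi> x \<noteq> \<pi> v}" by auto
  then have "card X \<le> mdeg \<pi> u X + mdeg \<pi> v X"
    unfolding mdeg_def by (metis (no_types, lifting) card_Un_le)
  then show False using assms by linarith
qed

lemma low_degree_other_part:
  assumes "finite X" "2 * mdeg \<pi> u X < card X" "card X \<le> 2 * mdeg \<pi> v X"
  shows "card X < 2 * mdeg \<pi> v X"
proof -
  have ne: "\<pi> u \<noteq> \<pi> v" using assms by (auto simp: mdeg_def)
  have "X = {x \<in> X. \<pi> x \<noteq> \<pi> u} \<union> {x \<in> X. \<pi> x \<noteq> \<pi> v}" using ne by auto
  then have "card X \<le> mdeg \<pi> u X + mdeg \<pi> v X"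
    unfolding mdeg_def by (metis (no_types, lifting) card_Un_le)
  then show ?thesis using assms by linarith
qed

lemma sum_card_pairs_le:
  assumes "finite \<C>" "\<And>B. B \<in> \<C> \<Longrightarrow> card B \<le> k"
  shows "(\<Sum>B\<in>\<C>. card B * (card B - 1)) \<le> (k - 1) * (\<Sum>B\<in>\<C>. card B)"
  unfolding sum_distrib_left using assms(2) by (intro sum_mono) (simp add: mult.commute diff_le_mono)

text \<open>Some block has a size s that is not a multiple of k, hence 1 \<le> s < k. It contributes
  s (s - 1) \<le> (k - 1) (s - 1) instead of (k - 1) s, which saves one multiple of k - 1.\<close>

lemma sum_card_pairs_less:
  assumes "finite \<C>" "\<And>B. B \<in> \<C> \<Longrightarrow> card B \<le> k" "\<not> k dvd (\<Sum>B\<in>\<C>. card B)"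
  shows "(\<Sum>B\<in>\<C>. card B * (card B - 1)) \<le> (k - 1) * ((\<Sum>B\<in>\<C>. card B) - 1)"
proof -
  obtain B where B: "B \<in> \<C>" "\<not> k dvd card B"
    using assms(3) dvd_sum[of \<C> k card] by blast
  define s where "s = card B"
  have "s \<noteq> 0" "s \<noteq> k"
    using B(2) unfolding s_def by (metis dvd_0_right, metis dvd_refl)
  moreover have "s \<le> k"
    using assms(2)[OF B(1)] unfolding s_def .
  ultimately have s: "1 \<le> s" "s < k" by linarith+
  have one: "s * (s - 1) \<le> (k - 1) * (s - 1)"
    using s by (intro mult_right_mono) auto
  have "(\<Sum>B\<in>\<C>. card B * (card B - 1)) = s * (s - 1) + (\<Sum>B\<in>\<C> - {B}. card B * (card B - 1))"
    using assms(1) B(1) unfolding s_def by (rule sum.remove)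
  also have "\<dots> \<le> (k - 1) * (s - 1) + (k - 1) * (\<Sum>B\<in>\<C> - {B}. card B)"
    using one assms by (intro add_mono sum_card_pairs_le) auto
  also have "\<dots> = (k - 1) * ((s - 1) + (\<Sum>B\<in>\<C> - {B}. card B))"
    by (simp add: distrib_left)
  also have "(s - 1) + (\<Sum>B\<in>\<C> - {B}. card B) = (\<Sum>B\<in>\<C>. card B) - 1"
    using sum.remove[OF assms(1) B(1), of card] s unfolding s_def by simp
  finally show ?thesis .
qed

text \<open>The set sought is \<open>X \<union> T\<close> with k - 1 vertices \<open>T\<close>
  outside \<open>X\<close>: the edges from \<open>T\<close> into \<open>X\<close> must make up for
  the edges \<open>E\<close> inside the other blocks. If k - 1 outside vertices see at least half of
  \<open>X\<close>, they suffice, because blocks of at most k vertices on r + k vertices have 2 E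
  \<le> (k - 1) (r + k). If there are fewer, all remaining outside vertices share a part, and each
  edge of \<open>E\<close> can be charged to a vertex of \<open>J\<close>, which has at most k - 1
  neighbours in its block and at least as many in \<open>X\<close>.\<close>

lemma sum_msize_le_few_outside:
  fixes \<pi> :: "'a \<Rightarrow> 'b"
  assumes V: "finite V" "card V = q + r" "partition_on V \<B>"
    and X: "X \<in> \<B>" "card X + k = q" and k: "1 \<le> k" "k \<le> Suc r"
    and le: "\<And>B. B \<in> \<B> - {X} \<Longrightarrow> card B \<le> k"
    and q: "4 * r \<le> q + 2" "1 \<le> r"
  obtains R where "R \<subseteq> V" "card R = q - 1" "(\<Sum>B\<in>\<B>. msize \<pi> B) \<le> msize \<pi> R"
proof -
  note result = that
  define s where "s = card X"
  define W where "W = V - X"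
  define \<C> where "\<C> = \<B> - {X}"
  have fB: "finite \<B>" using V finite_elements by metis
  have sub: "B \<subseteq> V" if "B \<in> \<B>" for B using that V(3) by (auto simp: partition_on_def)
  have fin: "finite B" if "B \<in> \<B>" for B using sub[OF that] V(1) finite_subset by blast
  have fC: "finite \<C>" unfolding \<C>_def using fB by simp
  have finX: "finite X" and finW: "finite W" using fin X V unfolding W_def by auto
  have s: "s + k = q" using X unfolding s_def by simp
  have cardW: "card W = r + k"
    unfolding W_def using card_Diff_subset[OF finX sub[OF X(1)]] V(2) s unfolding s_def by simp
  have UC: "\<Union>\<C> = W"
    using V(3) X(1) unfolding \<C>_def W_def partition_on_def disjoint_def by blast
  have disjC: "disjoint \<C>"
    using V(3) unfolding \<C>_def partition_on_def by (auto intro: pairwise_subset)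
  have sumC: "(\<Sum>B\<in>\<C>. card B) = r + k"
    using card_Union_disjoint[OF disjC] fin UC cardW unfolding \<C>_def by auto
  have s1: "1 \<le> s"
    using X(1) V(3) finX unfolding s_def by (metis One_nat_def Suc_leI card_gt_0_iff partition_on_def)
  \<comment> \<open>For r = 1 the hypothesis only yields q \<ge> 2, and q = 2 forces s = k = 1. For
    r \<ge> 2 already 4 r - 2 \<ge> 3 r.\<close>
  have large: "3 * r \<le> q \<or> k = 1"
  proof (cases "r = 1")
    case True
    then show ?thesis using q(1) s s1 k(1) by (cases "k = 1") simp_all
  next
    case False
    then have "2 \<le> r" using q(2) by linarith
    then show ?thesis using q(1) by linarith
  qed
  define J where "J = {u \<in> W. s \<le> 2 * mdeg \<pi> u X}"
  define E where "E = (\<Sum>B\<in>\<C>. msize \<pi> B)"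
  have finish: thesis if T: "T \<subseteq> W" "card T = k - 1" "E \<le> (\<Sum>u\<in>T. mdeg \<pi> u X)" for T
  proof (rule result[of "X \<union> T"])
    have finT: "finite T" and disj: "X \<inter> T = {}" using T finW finite_subset unfolding W_def by auto
    show "X \<union> T \<subseteq> V" using T sub X unfolding W_def by auto
    show "card (X \<union> T) = q - 1"
      using T s k finX finT disj by (simp add: card_Un_disjoint s_def)
    have "(\<Sum>B\<in>\<B>. msize \<pi> B) = msize \<pi> X + E"
      unfolding E_def \<C>_def using fB X(1) by (rule sum.remove)
    also have "\<dots> \<le> msize \<pi> (X \<union> T)"
      using T finX finT disj by (simp add: msize_Un)
    finally show "(\<Sum>B\<in>\<B>. msize \<pi> B) \<le> msize \<pi> (X \<union> T)" .
  qed
  have finJ: "finite J" using finW unfolding J_def by simp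
  show thesis
  proof (cases "k - 1 \<le> card J")
    case True
    then obtain T where T: "T \<subseteq> J" "card T = k - 1"
      using obtain_subset_with_card_n by blast
    have "(k - 1) * ((s + 1) div 2) \<le> (\<Sum>u\<in>T. mdeg \<pi> u X)"
    proof -
      have "(\<Sum>u\<in>T. (s + 1) div 2) \<le> (\<Sum>u\<in>T. mdeg \<pi> u X)"
        using T(1) by (intro sum_mono) (auto simp: J_def)
      then show ?thesis using T(2) by simp
    qed
    moreover have "2 * E \<le> (k - 1) * (2 * ((s + 1) div 2))"
    proof -
      have E: "2 * E \<le> (\<Sum>B\<in>\<C>. card B * (card B - 1))"
        unfolding E_def sum_distrib_left using msize_le[OF fin]
        by (intro sum_mono) (auto simp: \<C>_def)
      have kC: "\<And>B. B \<in> \<C> \<Longrightarrow> card B \<le> k" using le unfolding \<C>_def .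
      show ?thesis
      proof (cases "k = Suc r")
        \<comment> \<open>At the extreme k = r + 1 the estimate (k - 1) (r + k) may exceed what the
          half degrees supply. Since 0 < r < k, the total r + k is not a multiple of k, and the
          sharper count lowers r + k to 2 r.\<close>
        case True
        have "\<not> k dvd r + k"
          using True q by (metis dvd_add_triv_right_iff dvd_imp_le not_less_eq_eq le_refl
              less_eq_Suc_le One_nat_def)
        then have "2 * E \<le> (k - 1) * (r + k - 1)"
          using E sum_card_pairs_less[OF fC kC] unfolding sumC by linarith
        also have "\<dots> \<le> (k - 1) * (2 * ((s + 1) div 2))"
        proof (rule mult_left_mono)
          \<comment> \<open>Here s = q - r - 1 \<ge> 2 r - 1, so the half of s must be rounded
            up.\<close>
          show "r + k - 1 \<le> 2 * ((s + 1) div 2)"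
            using div_le_mono[of "2 * r" "s + 1" 2] True s q large by auto
        qed simp
        finally show ?thesis .
      next
        case False
        have half_up: "s \<le> 2 * ((s + 1) div 2)" by linarith
        have "2 * E \<le> (k - 1) * (r + k)"
          using E sum_card_pairs_le[OF fC kC] unfolding sumC by linarith
        also have "\<dots> \<le> (k - 1) * (2 * ((s + 1) div 2))"
        proof (cases "k = 1")
          case not_one: False
          show ?thesis
          proof (rule mult_left_mono)
            show "r + k \<le> 2 * ((s + 1) div 2)"
              using half_up False k s large not_one by linarith
          qed simp
        qed simp
        finally show ?thesis .
      qed
    qed
    ultimately have "E \<le> (\<Sum>u\<in>T. mdeg \<pi> u X)" by (simp add: mult.left_commute)
    then show ?thesis using finish[of T] T unfolding J_def by blast
  next
    case False
    \<comment> \<open>The vertices of \<open>W - J\<close> lie in a single part, so \<open>J\<close> meets every edge inside \<open>W\<close>.\<close>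
    have JW: "J \<subseteq> W" unfolding J_def by auto
    have "card (W - J) \<ge> k - 1 - card J"
      using card_Diff_subset[OF finJ JW] cardW by linarith
    \<comment> \<open>\<open>T'\<close> only pads \<open>J\<close> to k - 1 vertices; its edges into
      \<open>X\<close> are a bonus.\<close>
    then obtain T' where T': "T' \<subseteq> W - J" "card T' = k - 1 - card J"
      by (rule obtain_subset_with_card_n)
    have finT': "finite T'" using T' finW finite_subset by blast
    have "card J < card W" using False cardW by linarith
    then have "\<not> W \<subseteq> J" using finJ card_mono[of J W] by linarith
    then obtain u where "u \<in> W" "u \<notin> J" by blast
    then have u: "2 * mdeg \<pi> u X < s" unfolding J_def by simp
    have high: "k - 1 \<le> mdeg \<pi> v X" if "v \<in> J" for v
    proof -
      have "s < 2 * mdeg \<pi> v X"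
        using low_degree_other_part[OF finX, of \<pi> u v] u that unfolding J_def s_def by simp
      \<comment> \<open>From 3 (k - 1) \<le> 3 r \<le> q follows s + 1 = q - (k - 1) \<ge> 2 (k -
        1); for k = 1 the claim is trivial.\<close>
      then show ?thesis using s k large by linarith
    qed
    have "E \<le> (\<Sum>B\<in>\<C>. \<Sum>v\<in>B \<inter> J. k - 1)"
      unfolding E_def
    proof (rule sum_mono)
      fix B assume B: "B \<in> \<C>"
      then have finB: "finite B" using fin unfolding \<C>_def by auto
      have "msize \<pi> B \<le> (\<Sum>v\<in>B \<inter> J. mdeg \<pi> v B)"
      proof (rule msize_le_cover[OF finB])
        fix v w assume "v \<in> B - J" "w \<in> B - J"
        then have "v \<in> W - J" "w \<in> W - J" using B UC by auto
        then show "\<pi> v = \<pi> w"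
          using low_degree_same_part[OF finX, of \<pi> v w] unfolding J_def s_def by auto
      qed
      also have "\<dots> \<le> (\<Sum>v\<in>B \<inter> J. k - 1)"
      proof (rule sum_mono)
        fix v assume "v \<in> B \<inter> J"
        then show "mdeg \<pi> v B \<le> k - 1"
          using mdeg_less[OF finB, of v \<pi>] le[of B] B unfolding \<C>_def by auto
      qed
      finally show "msize \<pi> B \<le> (\<Sum>v\<in>B \<inter> J. k - 1)" .
    qed
    also have "\<dots> = (\<Sum>v\<in>(\<Union>B\<in>\<C>. B \<inter> J). k - 1)"
      using fC finJ disjC
      by (intro sum.UNION_disjoint[symmetric]) (auto simp: disjoint_def)
    also have "(\<Union>B\<in>\<C>. B \<inter> J) = J" using UC JW by auto
    also have "(\<Sum>v\<in>J. k - 1) \<le> (\<Sum>v\<in>J. mdeg \<pi> v X)"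
      by (rule sum_mono) (rule high)
    also have "\<dots> \<le> (\<Sum>v\<in>J \<union> T'. mdeg \<pi> v X)"
      using finJ finT' by (intro sum_mono2) auto
    finally have "E \<le> (\<Sum>v\<in>J \<union> T'. mdeg \<pi> v X)" .
    moreover have "card (J \<union> T') = k - 1"
      using T' False finJ finT' by (subst card_Un_disjoint) auto
    ultimately show ?thesis using finish[of "J \<union> T'"] JW T' by blast
  qed
qed

lemma sum_msize_blocks_le:
  fixes \<pi> :: "'a \<Rightarrow> 'b"
  assumes V: "finite V" "card V = q + r" "partition_on V \<B>" and two: "card \<B> \<ge> 2"
    and pair: "\<And>B C. B \<in> \<B> \<Longrightarrow> C \<in> \<B> \<Longrightarrow> B \<noteq> C \<Longrightarrow> card B + card C \<le> q"
    and q: "4 * r \<le> q + 2" "1 \<le> r"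
    and S: "S \<in> greedy_min_degree_sets (Suc r) (mgraph \<pi> V)"
  shows "(\<Sum>B\<in>\<B>. msize \<pi> B) \<le> msize \<pi> (V - S)"
proof -
  have fB: "finite \<B>" and neB: "\<B> \<noteq> {}" using two by (auto intro: card_ge_0_finite)
  have "finite (card ` \<B>)" "card ` \<B> \<noteq> {}" using fB neB by blast+
  then have "Max (card ` \<B>) \<in> card ` \<B>" by (rule Max_in)
  then obtain X where X: "X \<in> \<B>" "Max (card ` \<B>) = card X" by auto
  have X_max: "card B \<le> card X" if "B \<in> \<B>" for B
    using that fB X(2) Max_ge[of "card ` \<B>" "card B"] by simp
  have pos: "1 \<le> card B" if "B \<in> \<B>" for B
    using that V by (metis One_nat_def Suc_leI Union_upper card_gt_0_iff finite_subset partition_on_def)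
  have "\<not> \<B> \<subseteq> {X}" using two card_mono[of "{X}" \<B>] by auto
  then obtain Y where "Y \<in> \<B>" "Y \<noteq> X" by auto
  then have Xq: "card X + 1 \<le> q" using pair[of X Y] X(1) pos[of Y] by simp
  define k where "k = q - card X"
  have k: "card X + k = q" "1 \<le> k" using Xq unfolding k_def by auto
  have le: "card B \<le> k" if B: "B \<in> \<B> - {X}" for B
  proof -
    have "card X + card B \<le> q" using B X(1) by (intro pair) blast+
    then show ?thesis unfolding k_def by simp
  qed
  show ?thesis
  proof (cases "k \<le> Suc r")
    case True
    obtain R where R: "R \<subseteq> V" "card R = q - 1" "(\<Sum>B\<in>\<B>. msize \<pi> B) \<le> msize \<pi> R"
      using sum_msize_le_few_outside[OF V X(1) k True le q] by blast
    have "finite R" using R V finite_subset by blast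
    then have "card (V - R) = Suc r"
      using R V(2) Xq by (simp add: card_Diff_subset)
    then have "msize \<pi> (V - (V - R)) \<le> msize \<pi> (V - S)"
      by (intro greedy_optimal[OF S V(1)]) auto
    moreover have "V - (V - R) = R" using R by auto
    ultimately show ?thesis using R by simp
  next
    case False
    then obtain j where j: "q = card X + r + 2 + j"
      using k by (metis Suc_leI add.assoc add_2_eq_Suc' le_iff_add linorder_not_le add_Suc_right)
    have "card B * (q + r - 1) \<le> (q - 1) * (q - 2)" if "B \<in> \<B>" for B
    proof -
      have "card B * (q + r - 1) \<le> card X * (q + r - 1)"
        using X_max[OF that] by simp
      also have "\<dots> \<le> (q - 1) * (q - 2)"
        \<comment> \<open>With x = |X| the right side exceeds the left by x j + (r + j) (r + j +
          1).\<close>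
        unfolding j by (simp add: algebra_simps)
      finally show ?thesis .
    qed
    then show ?thesis
      using q j by (intro sum_msize_le_average[OF V _ S]) auto
  qed
qed

section \<open>Components of rainbow subgraphs\<close>

text \<open>Components are closures of the adjacency relation rather than sets of endpoints of
  walks, so that containment proofs reduce to closure under one step (\<open>comp_least\<close>). A
  vertex on no edge is its own component.\<close>

definition comp :: "'a set set \<Rightarrow> 'a \<Rightarrow> 'a set" where
  "comp F v = {(x, y). {x, y} \<in> F}\<^sup>* `` {v}"

lemma comp_self [simp]: "v \<in> comp F v"
  by (simp add: comp_def)

lemma comp_nonempty [simp]: "comp F v \<noteq> {}"
  by (auto simp: comp_def)

lemma comp_step: "x \<in> comp F v \<Longrightarrow> {x, y} \<in> F \<Longrightarrow> y \<in> comp F v"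
  unfolding comp_def by (auto intro: rtrancl_into_rtrancl)

lemma comp_least:
  assumes "v \<in> X" "\<And>x y. x \<in> X \<Longrightarrow> {x, y} \<in> F \<Longrightarrow> y \<in> X"
  shows "comp F v \<subseteq> X"
proof
  fix w assume "w \<in> comp F v"
  then have "(v, w) \<in> {(x, y). {x, y} \<in> F}\<^sup>*" by (simp add: comp_def)
  then show "w \<in> X" by induction (use assms in auto)
qed

lemma comp_sym: "w \<in> comp F v \<Longrightarrow> v \<in> comp F w"
proof -
  have "sym ({(x, y). {x, y} \<in> F}\<^sup>*)"
    by (intro sym_rtrancl symI) (auto simp: insert_commute)
  then show "w \<in> comp F v \<Longrightarrow> v \<in> comp F w"
    unfolding comp_def by (auto dest: symD)
qed

lemma comp_trans: "w \<in> comp F v \<Longrightarrow> comp F w \<subseteq> comp F v"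
  by (rule comp_least) (auto intro: comp_step)

lemma comp_eq: "w \<in> comp F v \<Longrightarrow> comp F w = comp F v"
  by (simp add: comp_sym comp_trans subset_antisym)

lemma comp_disjoint: "comp F v \<noteq> comp F w \<Longrightarrow> comp F v \<inter> comp F w = {}"
  by (metis comp_eq disjoint_iff)

lemma comp_mono: "F \<subseteq> F' \<Longrightarrow> comp F v \<subseteq> comp F' v"
  by (rule comp_least) (auto intro: comp_step)

text \<open>A step from a vertex of the component uses an edge meeting the component, hence never
  \<open>e\<close>.\<close>

lemma comp_remove_other:
  assumes "e \<inter> comp F v = {}"
  shows "comp (F - {e}) v = comp F v"
proof (rule subset_antisym)
  have "comp F v \<subseteq> comp F v \<inter> comp (F - {e}) v"
    by (rule comp_least) (use assms in \<open>auto intro: comp_step\<close>)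
  then show "comp F v \<subseteq> comp (F - {e}) v" by blast
qed (auto intro!: comp_mono)

lemma comp_split:
  assumes "{y, z} \<in> F"
  shows "comp F y = comp (F - {{y, z}}) y \<union> comp (F - {{y, z}}) z"
proof (rule subset_antisym)
  show "comp F y \<subseteq> comp (F - {{y, z}}) y \<union> comp (F - {{y, z}}) z"
  proof (rule comp_least)
    fix u w
    assume u: "u \<in> comp (F - {{y, z}}) y \<union> comp (F - {{y, z}}) z" and "{u, w} \<in> F"
    then show "w \<in> comp (F - {{y, z}}) y \<union> comp (F - {{y, z}}) z"
      by (cases "{u, w} = {y, z}") (auto simp: doubleton_eq_iff intro: comp_step)
  qed simp
  have "z \<in> comp F y" using assms comp_step comp_self by metis
  then show "comp (F - {{y, z}}) y \<union> comp (F - {{y, z}}) z \<subseteq> comp F y"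
    using comp_mono[of "F - {{y, z}}" F y] comp_mono[of "F - {{y, z}}" F z] comp_eq[of z F y] by auto
qed

lemma comp_subset:
  assumes "F \<subseteq> medges \<pi> V" "v \<in> V"
  shows "comp F v \<subseteq> V"
proof (rule comp_least)
  fix x y assume "{x, y} \<in> F"
  then show "y \<in> V" using assms(1) by (auto dest: subsetD)
qed (rule assms(2))

text \<open>\<open>F\<close> contains exactly one edge of each colour. Maximality ranges over all
  such systems and all vertices; taken for \<open>F\<close> itself it says that no component of
  \<open>F\<close> is larger than that of \<open>a\<^sub>0\<close>.\<close>

locale maximal_rainbow =
  fixes \<pi> :: "'a \<Rightarrow> 'b" and V :: "'a set" and c :: "'a set \<Rightarrow> 'c" and F :: "'a set set" and a\<^sub>0 :: 'a
  assumes fin: "finite V" and F: "F \<subseteq> medges \<pi> V" "inj_on c F" "c ` F = c ` medges \<pi> V"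
    and a\<^sub>0: "a\<^sub>0 \<in> V"
    and maximal: "\<And>F' v. F' \<subseteq> medges \<pi> V \<Longrightarrow> inj_on c F' \<Longrightarrow> c ` F' = c ` medges \<pi> V \<Longrightarrow> v \<in> V
      \<Longrightarrow> card (comp F' v) \<le> card (comp F a\<^sub>0)"
begin

definition "A = comp F a\<^sub>0"

definition "bridge y z \<longleftrightarrow> {y, z} \<in> F \<and> y \<in> A \<and> z \<in> A \<and> z \<notin> comp (F - {{y, z}}) y"

lemma A_subset: "A \<subseteq> V"
  unfolding A_def using comp_subset F a\<^sub>0 by metis

lemma finite_comp [simp]: "v \<in> V \<Longrightarrow> F' \<subseteq> F \<Longrightarrow> finite (comp F' v)"
  using comp_subset[of F' \<pi> V v] F fin finite_subset by blast

lemma finite_A [simp]: "finite A"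
  using A_subset fin finite_subset by blast

lemma comp_in_A: "a \<in> A \<Longrightarrow> comp F a = A"
  unfolding A_def by (rule comp_eq)

lemma comp_outside_A:
  assumes "x \<notin> A"
  shows "comp F x \<inter> A = {}"
proof (rule ccontr)
  assume "comp F x \<inter> A \<noteq> {}"
  then obtain w where "w \<in> comp F x" "w \<in> A" by blast
  then have "comp F x = A" using comp_eq[of w F x] comp_in_A[of w] by simp
  then show False using assms comp_self[of x F] by simp
qed

lemma bridge_commute: "bridge y z \<Longrightarrow> bridge z y"
  unfolding bridge_def using comp_sym by (metis insert_commute)

lemma bridge_sides:
  assumes "bridge y z"
  shows "A = comp (F - {{y, z}}) y \<union> comp (F - {{y, z}}) z"
    and "comp (F - {{y, z}}) y \<inter> comp (F - {{y, z}}) z = {}"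
    and "card A = card (comp (F - {{y, z}}) y) + card (comp (F - {{y, z}}) z)"
proof -
  show *: "A = comp (F - {{y, z}}) y \<union> comp (F - {{y, z}}) z"
    using assms comp_split comp_in_A unfolding bridge_def by metis
  show **: "comp (F - {{y, z}}) y \<inter> comp (F - {{y, z}}) z = {}"
    using assms comp_disjoint comp_self unfolding bridge_def by metis
  show "card A = card (comp (F - {{y, z}}) y) + card (comp (F - {{y, z}}) z)"
    using * ** finite_A by (metis card_Un_disjoint finite_Un)
qed

text \<open>Swap the edge \<open>{a, x}\<close> into \<open>F\<close> for the edge of \<open>F\<close> of the same colour. By
  maximality the latter is a bridge of \<open>A\<close> whose removal pays for the vertices gained.\<close>

lemma leaving_edge_bridge:
  assumes a: "a \<in> A" and x: "x \<in> V" "x \<notin> A" and ax: "\<pi> a \<noteq> \<pi> x"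
  obtains y z where "bridge y z" "a \<in> comp (F - {{y, z}}) y"
    "card (comp (F - {{y, z}}) y) + card (comp F x) \<le> card A"
proof -
  have aV: "a \<in> V" using a A_subset by blast
  have e: "{a, x} \<in> medges \<pi> V" using aV x ax by simp
  then obtain e' where e': "e' \<in> F" "c e' = c {a, x}"
    using F(3) by (metis imageE image_eqI)
  have eF: "{a, x} \<notin> F" using a x comp_step unfolding A_def by metis
  define D where "D = F - {e'}"
  define F' where "F' = insert {a, x} D"
  have "inj_on c F'"
    unfolding F'_def using e' F(2) eF unfolding D_def
    by (auto simp: inj_on_def)
  moreover have "c ` F' = c ` medges \<pi> V"
  proof -
    have "F = insert e' D" using e'(1) unfolding D_def by auto
    then have "c ` F' = c ` F" using e'(2) unfolding F'_def by (metis image_insert)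
    then show ?thesis using F(3) by simp
  qed
  ultimately have max: "card (comp F' a) \<le> card A"
    using maximal[of F' a] aV e F(1) unfolding A_def F'_def D_def by auto
  have sub: "comp D a \<subseteq> comp F' a" by (rule comp_mono) (auto simp: F'_def)
  have xF': "x \<in> comp F' a" by (rule comp_step[of a]) (auto simp: F'_def)
  have finF': "finite (comp F' a)"
    using comp_subset[of F' \<pi> V a] aV e F(1) fin finite_subset unfolding F'_def D_def by blast
  \<comment> \<open>If \<open>a\<close> still reached all of \<open>A\<close> without
    \<open>e'\<close>, the swapped system would have a component containing \<open>A\<close> and
    \<open>x\<close>.\<close>
  have proper: "comp D a \<noteq> A"
  proof
    assume "comp D a = A"
    then have "insert x A \<subseteq> comp F' a" using sub xF' by auto
    then have "card (insert x A) \<le> card (comp F' a)" using finF' by (rule card_mono[rotated])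
    then show False using x max by simp
  qed
  obtain y z where yz: "e' = {y, z}" "a \<in> comp D y" "y \<in> A" "z \<in> A"
  proof -
    have "e' \<inter> A \<noteq> {}"
      using proper comp_remove_other comp_in_A[OF a] unfolding D_def by metis
    moreover obtain u w where uw: "e' = {u, w}" using e'(1) F(1) by (blast elim: medgesE)
    ultimately have "u \<in> A" "w \<in> A"
      using e'(1) comp_step[of u F a\<^sub>0 w] comp_step[of w F a\<^sub>0 u] unfolding A_def
      by (auto simp: insert_commute)
    moreover have "a \<in> comp D u \<union> comp D w"
      using comp_split[of u w F] comp_in_A[OF \<open>u \<in> A\<close>] e'(1) a unfolding uw D_def by simp
    ultimately show ?thesis
      using that[of u w] that[of w u] uw by (auto simp: insert_commute)
  qed
  have Da: "comp D y = comp D a" using comp_eq[OF yz(2)] by simp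
  have "z \<notin> comp D y"
    using comp_split[of y z F] comp_in_A[OF yz(3)] e'(1) proper Da comp_eq[of z D y]
    unfolding yz(1) D_def by auto
  then have br: "bridge y z"
    unfolding bridge_def using yz e'(1) by (simp add: D_def)
  have "e' \<inter> comp F x = {}"
    using yz comp_outside_A[OF x(2)] by auto
  then have Dx: "comp D x = comp F x" unfolding D_def by (rule comp_remove_other)
  have "comp D x \<subseteq> comp F' x" by (rule comp_mono) (auto simp: F'_def)
  also have "\<dots> = comp F' a" using xF' by (rule comp_eq)
  \<comment> \<open>The new edge joins the side of \<open>a\<close> to the component of
    \<open>x\<close>, which is intact because \<open>e'\<close> lies in \<open>A\<close>.\<close>
  finally have "comp D y \<union> comp F x \<subseteq> comp F' a" using sub Da Dx by auto
  moreover have "comp D y \<inter> comp F x = {}"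
  proof -
    have "comp D y \<subseteq> A" using bridge_sides(1)[OF br] unfolding D_def yz(1) by auto
    then show ?thesis using comp_outside_A[OF x(2)] by blast
  qed
  ultimately have "card (comp D y) + card (comp F x) \<le> card (comp F' a)"
    using card_mono[OF finF'] finite_subset[OF _ finF'] by (metis card_Un_disjoint finite_Un)
  then have "card (comp D y) + card (comp F x) \<le> card A" using max by simp
  then show thesis
    by (rule that[OF br yz(2)[unfolded D_def yz(1)], folded yz(1), folded D_def])
qed

text \<open>Among all bridges choose one whose larger side \<open>Z\<close>, at the end
  \<open>z\<close>, is smallest. If \<open>Z\<close> were too large, a leaving edge at
  \<open>z\<close> would yield a bridge \<open>e\<close> whose side \<open>Y'\<close> containing
  \<open>z\<close> is smaller than \<open>Z\<close>. Then \<open>e\<close> avoids the other side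
  \<open>Y\<close>, so \<open>Y'\<close> swallows \<open>Y\<close> together with \<open>z\<close>,
  and the far side \<open>Z'\<close> is a proper subset of \<open>Z\<close>. Both sides of
  \<open>e\<close> are now smaller than \<open>Z\<close>, a contradiction.\<close>

lemma balanced_bridge:
  assumes "\<And>a. a \<in> A \<Longrightarrow> \<exists>x. x \<in> V \<and> x \<notin> A \<and> \<pi> a \<noteq> \<pi> x \<and> card (comp F x) = b"
  obtains y z where "bridge y z" "card (comp (F - {{y, z}}) y) + b \<le> card A"
    "card (comp (F - {{y, z}}) z) + b \<le> card A"
proof -
  have step: "\<exists>y z. bridge y z \<and> a \<in> comp (F - {{y, z}}) y \<and> card (comp (F - {{y, z}}) y) + b \<le> card A"
    if "a \<in> A" for a
    using assms[OF that] leaving_edge_bridge[OF that] by metis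
  define good where "good = (\<lambda>(y, z). bridge y z
    \<and> card (comp (F - {{y, z}}) y) \<le> card (comp (F - {{y, z}}) z))"
  have orient: "good (y, z) \<or> good (z, y)" if "bridge y z" for y z
    using that bridge_commute[OF that] unfolding good_def by (auto simp: insert_commute)
  define \<mu> where "\<mu> = (\<lambda>(y, z). card (comp (F - {{y, z}}) z))"
  have "a\<^sub>0 \<in> A" unfolding A_def by simp
  then have "\<exists>p. good p" using step[of a\<^sub>0] orient by blast
  then obtain p where p: "good p" "\<And>p'. good p' \<Longrightarrow> \<mu> p \<le> \<mu> p'"
    using exists_least_iff[of "\<lambda>k. \<exists>p. good p \<and> \<mu> p = k"] by (metis linorder_not_le)
  obtain y z where yz: "p = (y, z)" by fastforce
  define D where "D = F - {{y, z}}"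
  define Y where "Y = comp D y"
  define Z where "Z = comp D z"
  have br: "bridge y z" and le: "card Y \<le> card Z"
    using p(1) unfolding yz good_def Y_def Z_def D_def by auto
  note sides = bridge_sides[OF br, folded D_def, folded Y_def Z_def]
  have zA: "z \<in> A" and yzF: "{y, z} \<in> F" using br unfolding bridge_def by auto
  have "card Z + b \<le> card A"
  proof (rule ccontr)
    assume contra: "\<not> card Z + b \<le> card A"
    obtain y' z' where br': "bridge y' z'" and z: "z \<in> comp (F - {{y', z'}}) y'"
      and le': "card (comp (F - {{y', z'}}) y') + b \<le> card A"
      using step[OF zA] by blast
    define e where "e = {y', z'}"
    define Y' where "Y' = comp (F - {e}) y'"
    define Z' where "Z' = comp (F - {e}) z'"
    note sides' = bridge_sides[OF br', folded e_def, folded Y'_def Z'_def]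
    have zY': "comp (F - {e}) z = Y'" using z comp_eq unfolding Y'_def e_def by metis
    have eF: "e \<in> F" using br' unfolding bridge_def e_def by simp
    have "card Y' + b \<le> card A" using le' unfolding Y'_def e_def .
    then have less: "card Y' < card Z" using contra by simp
    have finY': "finite Y'" using sides'(1) finite_A by (metis finite_Un)
    \<comment> \<open>Otherwise removing \<open>e\<close> leaves \<open>Z\<close> connected, so
      \<open>Y'\<close>, the side containing \<open>z\<close>, would have at least |Z|
      vertices.\<close>
    have eY: "e \<inter> Y = {}"
    proof (rule ccontr)
      assume meet: "e \<inter> Y \<noteq> {}"
      show False
      proof (cases "e = {y, z}")
        case True
        then show False using zY' less unfolding Z_def D_def by simp
      next
        case False
        then have "{y', z'} \<in> D" using eF unfolding D_def e_def by simp
        then have "e \<subseteq> Y"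
          using meet comp_step[of y' D y z'] comp_step[of z' D y y'] unfolding Y_def e_def
          by (auto simp: insert_commute)
        then have "e \<inter> comp D z = {}" using sides(2) unfolding Z_def by auto
        then have "Z = comp (D - {e}) z" unfolding Z_def using comp_remove_other by metis
        also have "\<dots> \<subseteq> comp (F - {e}) z" by (rule comp_mono) (auto simp: D_def)
        finally have "card Z \<le> card Y'" using zY' finY' card_mono by metis
        then show False using less by simp
      qed
    qed
    have "e \<noteq> {y, z}" using eY unfolding Y_def by auto
    have "Y = comp (D - {e}) y" using eY comp_remove_other unfolding Y_def by metis
    also have "\<dots> \<subseteq> comp (F - {e}) y" by (rule comp_mono) (auto simp: D_def)
    also have "\<dots> = comp (F - {e}) z"
    proof (rule comp_eq)
      have "{z, y} \<in> F - {e}" using yzF \<open>e \<noteq> {y, z}\<close> by (simp add: insert_commute)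
      then show "y \<in> comp (F - {e}) z" using comp_step comp_self by metis
    qed
    finally have "Y \<subseteq> Y'" using zY' by simp
    moreover have "z \<in> Y'" using zY' comp_self by metis
    moreover have "z \<in> Z" unfolding Z_def by simp
    ultimately have "Z' \<subset> Z" using sides(1,2) sides'(1,2) by blast
    then have "card Z' < card Z" using sides(1) finite_A by (metis finite_Un psubset_card_mono)
    moreover have "good (y', z') \<or> good (z', y')" by (rule orient[OF br'])
    ultimately show False
      using less p(2)[of "(y', z')"] p(2)[of "(z', y')"]
      unfolding \<mu>_def yz Y'_def Z'_def e_def Z_def D_def by (auto simp: insert_commute)
  qed
  then show thesis
    using that[OF br] le unfolding Y_def Z_def D_def by linarith
qed

text \<open>Let b be the size of the largest component outside \<open>A\<close>. If b = 1, any
  bridge serves, as each side has at most |A| - 1 vertices. Otherwise such a component contains an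
  edge; its ends carry different labels, so every vertex of \<open>A\<close> is adjacent to one of
  them, and \<open>balanced_bridge\<close> applies. Two blocks inside \<open>A\<close> are its two
  sides and have |A| \<le> q vertices; a side and an outside component are controlled by b; two
  outside components are controlled by the size of \<open>V\<close>.\<close>

lemma splitting_bridge:
  assumes q: "card A \<le> q" "q < card V" "2 * card V < 3 * (q + 1)"
    and uv: "u \<in> V" "v \<in> V" "\<pi> u \<noteq> \<pi> v"
  obtains y z where "bridge y z"
    "\<forall>u\<in>V. \<forall>v\<in>V. comp (F - {{y, z}}) u \<noteq> comp (F - {{y, z}}) v
      \<longrightarrow> card (comp (F - {{y, z}}) u) + card (comp (F - {{y, z}}) v) \<le> q"
proof -
  have ne: "V - A \<noteq> {}"
    using q A_subset fin by (metis Diff_eq_empty_iff card_mono finite_A linorder_not_le order_trans)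
  let ?K = "(\<lambda>x. card (comp F x)) ` (V - A)"
  have K: "finite ?K" "?K \<noteq> {}" using ne fin by auto
  define b where "b = Max ?K"
  have "b \<in> ?K" unfolding b_def using K by (rule Max_in)
  then obtain x\<^sub>0 where x\<^sub>0: "x\<^sub>0 \<in> V" "x\<^sub>0 \<notin> A" "card (comp F x\<^sub>0) = b" by auto
  have b: "card (comp F x) \<le> b" if "x \<in> V" "x \<notin> A" for x
    unfolding b_def using K that by (intro Max_ge) auto
  have "\<exists>y z. bridge y z \<and> card (comp (F - {{y, z}}) y) + b \<le> q \<and> card (comp (F - {{y, z}}) z) + b \<le> q"
  proof (cases "comp F x\<^sub>0 = {x\<^sub>0}")
    case True
    then have b1: "b = 1" using x\<^sub>0 by simp
    obtain a x where ax: "a \<in> A" "x \<in> V" "x \<notin> A" "\<pi> a \<noteq> \<pi> x"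
    proof (cases "\<pi> a\<^sub>0 = \<pi> x\<^sub>0")
      case False
      then show ?thesis using that[of a\<^sub>0 x\<^sub>0] x\<^sub>0 unfolding A_def by simp
    next
      case True
      \<comment> \<open>\<open>w\<close> lies in a part different from that of both
        \<open>a\<^sub>0\<close> and \<open>x\<^sub>0\<close>, so it is joined to both, and one of
        these edges leaves \<open>A\<close>.\<close>
      obtain w where w: "w \<in> V" "\<pi> w \<noteq> \<pi> a\<^sub>0" using uv by metis
      then show ?thesis
        using that[of a\<^sub>0 w] that[of w x\<^sub>0] x\<^sub>0 True unfolding A_def by (cases "w \<in> A") (auto simp: A_def)
    qed
    obtain y z where br: "bridge y z" using leaving_edge_bridge[OF ax] by blast
    have "card (comp (F - {{y, z}}) y) > 0" "card (comp (F - {{y, z}}) z) > 0"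
      using bridge_sides(1)[OF br] finite_A by (metis card_gt_0_iff comp_self empty_iff finite_Un)+
    then show ?thesis using br b1 bridge_sides(3)[OF br] q(1) by (intro exI[of _ y] exI[of _ z]) auto
  next
    case False
    have "\<exists>x\<^sub>1. {x\<^sub>0, x\<^sub>1} \<in> F"
    proof (rule ccontr)
      assume "\<nexists>x\<^sub>1. {x\<^sub>0, x\<^sub>1} \<in> F"
      then have "comp F x\<^sub>0 \<subseteq> {x\<^sub>0}" by (intro comp_least) auto
      then have "comp F x\<^sub>0 = {x\<^sub>0}" using comp_self[of x\<^sub>0 F] by (intro subset_antisym) simp_all
      then show False using False by simp
    qed
    then obtain x\<^sub>1 where x\<^sub>1: "{x\<^sub>0, x\<^sub>1} \<in> F" by blast
    then have "{x\<^sub>0, x\<^sub>1} \<in> medges \<pi> V" using F(1) by (rule subsetD[rotated])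
    then have "x\<^sub>1 \<in> V" "\<pi> x\<^sub>0 \<noteq> \<pi> x\<^sub>1" by simp_all
    moreover have c1: "x\<^sub>1 \<in> comp F x\<^sub>0" using x\<^sub>1 by (rule comp_step[OF comp_self])
    moreover have "x\<^sub>1 \<notin> A" using c1 comp_outside_A[OF x\<^sub>0(2)] by auto
    moreover have "card (comp F x\<^sub>1) = b" using comp_eq[OF c1] x\<^sub>0 by simp
    ultimately have "\<exists>x. x \<in> V \<and> x \<notin> A \<and> \<pi> a \<noteq> \<pi> x \<and> card (comp F x) = b" for a
      using x\<^sub>0 by (cases "\<pi> a = \<pi> x\<^sub>0") auto
    then obtain y z where "bridge y z" "card (comp (F - {{y, z}}) y) + b \<le> card A"
      "card (comp (F - {{y, z}}) z) + b \<le> card A"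
      by (rule balanced_bridge)
    then show ?thesis using q(1) by (meson le_trans)
  qed
  then obtain y z where br: "bridge y z"
    and sum: "card (comp (F - {{y, z}}) y) + b \<le> q" "card (comp (F - {{y, z}}) z) + b \<le> q"
    by blast
  define D where "D = F - {{y, z}}"
  note sides = bridge_sides[OF br, folded D_def]
  have inside: "comp D w = comp D y \<or> comp D w = comp D z" if "w \<in> A" for w
    using that sides(1) comp_eq[of w D y] comp_eq[of w D z] by auto
  have outside: "comp D w = comp F w" if "w \<notin> A" for w
    unfolding D_def using comp_outside_A[OF that] br unfolding bridge_def by (intro comp_remove_other) auto
  have mixed: "card (comp D u) + card (comp D v) \<le> q" if "u \<in> A" "v \<in> V" "v \<notin> A" for u v
    using inside[OF that(1)] b[OF that(2,3)] outside[OF that(3)] sum unfolding D_def by auto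
  have "card (comp D u) + card (comp D v) \<le> q"
    if uv: "u \<in> V" "v \<in> V" "comp D u \<noteq> comp D v" for u v
  proof (cases "u \<in> A"; cases "v \<in> A")
    assume "u \<in> A" "v \<in> A"
    then show ?thesis
      using inside[of u] inside[of v] uv(3) sides(3) q(1) by auto
  next
    assume "u \<in> A" "v \<notin> A"
    then show ?thesis using mixed uv by blast
  next
    assume "u \<notin> A" "v \<in> A"
    then show ?thesis using mixed[of v u] uv by (simp add: add.commute)
  next
    assume nA: "u \<notin> A" "v \<notin> A"
    let ?B = "comp F u" and ?C = "comp F v"
    have eq: "comp D u = ?B" "comp D v = ?C" using nA outside by auto
    have disj: "?B \<inter> ?C = {}" using uv(3) comp_disjoint unfolding eq by metis
    have fins: "finite ?B" "finite ?C" using uv by auto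
    have "card (A \<union> (?B \<union> ?C)) = card A + (card ?B + card ?C)"
      using disj comp_outside_A[OF nA(1)] comp_outside_A[OF nA(2)] fins
      by (subst card_Un_disjoint; (subst card_Un_disjoint)?) auto
    moreover have "card (A \<union> (?B \<union> ?C)) \<le> card V"
      using A_subset comp_subset[OF F(1)] uv fin by (intro card_mono) auto
    moreover have "card ?B \<le> card A" "card ?C \<le> card A"
      using maximal[OF F] uv unfolding A_def by auto
    ultimately have le: "card A + (card ?B + card ?C) \<le> card V" "card ?B \<le> card A" "card ?C \<le> card A"
      by simp_all
    have "card ?B + card ?C \<le> 2 * card A"
      using add_mono[OF le(2,3)] by simp
    then have "3 * (card ?B + card ?C) \<le> 2 * card A + 2 * (card ?B + card ?C)" by simp
    also have "\<dots> \<le> 2 * card V" using mult_le_mono2[OF le(1), of 2] by (simp add: distrib_left)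
    also note q(3)
    finally have "card ?B + card ?C \<le> q" by simp
    then show ?thesis unfolding eq .
  qed
  then show thesis using that[OF br] unfolding D_def by blast
qed

end

section \<open>Counting colours block by block\<close>

lemma partition_on_comp:
  assumes "F \<subseteq> medges \<pi> V"
  shows "partition_on V (comp F ` V)"
proof (rule partition_onI)
  show "\<Union> (comp F ` V) = V"
    using comp_subset[OF assms] comp_self[of _ F] by (intro subset_antisym) auto
  show "{} \<notin> comp F ` V"
    by (auto simp: eq_commute[of "{}"])
  show "disjnt B C" if "B \<in> comp F ` V" "C \<in> comp F ` V" "B \<noteq> C" for B C
    using that comp_disjoint[of F] unfolding disjnt_def by (metis imageE)
qed

lemma card_le_sum_comp:
  assumes "F \<subseteq> medges \<pi> V" "finite V"
  shows "card F \<le> (\<Sum>B\<in>comp F ` V. msize \<pi> B)"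
proof -
  have "F \<subseteq> (\<Union>B\<in>comp F ` V. medges \<pi> B)"
  proof
    fix e assume e: "e \<in> F"
    then obtain u v where uv: "e = {u, v}" "u \<in> V" "v \<in> V" "\<pi> u \<noteq> \<pi> v"
      using assms(1) by (blast elim: medgesE)
    then have "v \<in> comp F u" using e comp_step[of u F u v] by simp
    then show "e \<in> (\<Union>B\<in>comp F ` V. medges \<pi> B)"
      using uv by (intro UN_I[of "comp F u"]) auto
  qed
  moreover have "finite (\<Union>B\<in>comp F ` V. medges \<pi> B)"
    using assms comp_subset[OF assms(1)] by (auto intro!: finite_medges intro: finite_subset)
  ultimately have "card F \<le> card (\<Union>B\<in>comp F ` V. medges \<pi> B)" by (rule card_mono[rotated])
  also have "\<dots> \<le> (\<Sum>B\<in>comp F ` V. msize \<pi> B)"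
    using assms(2) by (intro card_UN_le) auto
  finally show ?thesis .
qed

text \<open>The absence of a rainbow tree enters only as \<open>small\<close>: a component with more
  than q vertices contains a tree with q edges, and any subgraph of a rainbow graph is
  rainbow.\<close>

lemma colors_le_of_small_components:
  fixes \<pi> :: "'a \<Rightarrow> 'b"
  assumes V: "finite V" "card V = q + r" and q: "4 * r \<le> q + 2" "1 \<le> r"
    and uv: "u \<in> V" "v \<in> V" "\<pi> u \<noteq> \<pi> v"
    and small: "\<And>F v. F \<subseteq> medges \<pi> V \<Longrightarrow> inj_on c F \<Longrightarrow> v \<in> V \<Longrightarrow> card (comp F v) \<le> q"
    and S: "S \<in> greedy_min_degree_sets (Suc r) (mgraph \<pi> V)"
  shows "card (c ` medges \<pi> V) \<le> msize \<pi> (V - S) + 1"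
proof -
  define good where "good = (\<lambda>(F, v). F \<subseteq> medges \<pi> V \<and> inj_on c F \<and> c ` F = c ` medges \<pi> V \<and> v \<in> V)"
  obtain F\<^sub>0 where "F\<^sub>0 \<subseteq> medges \<pi> V" "inj_on c F\<^sub>0" "c ` F\<^sub>0 = c ` medges \<pi> V"
    using subset_image_inj[of "c ` medges \<pi> V" c "medges \<pi> V"] by auto
  then have "good (F\<^sub>0, u)" unfolding good_def using uv by simp
  define \<mu> where "\<mu> = (\<lambda>(F :: 'a set set, v :: 'a). card (comp F v))"
  have "\<forall>p. good p \<longrightarrow> \<mu> p < Suc q"
    using small unfolding good_def \<mu>_def by (auto simp: less_Suc_eq_le)
  \<comment> \<open>The bound q on component sizes makes the maximum over all systems and vertices
    attained.\<close>
  then have "\<exists>p. good p \<and> (\<forall>p'. good p' \<longrightarrow> \<mu> p' \<le> \<mu> p)"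
    by (rule ex_has_greatest_nat[of good "(F\<^sub>0, u)" \<mu> "Suc q", OF \<open>good (F\<^sub>0, u)\<close>])
  then obtain p where p: "good p" "\<And>p'. good p' \<Longrightarrow> \<mu> p' \<le> \<mu> p" by auto
  obtain F a where Fa: "p = (F, a)" by fastforce
  have F: "F \<subseteq> medges \<pi> V" "inj_on c F" "c ` F = c ` medges \<pi> V" and a: "a \<in> V"
    using p(1) unfolding good_def Fa by auto
  interpret maximal_rainbow \<pi> V c F a
  proof
    fix F' w assume "F' \<subseteq> medges \<pi> V" "inj_on c F'" "c ` F' = c ` medges \<pi> V" "w \<in> V"
    then show "card (comp F' w) \<le> card (comp F a)"
      using p(2)[of "(F', w)"] unfolding good_def \<mu>_def Fa by simp
  qed (use V(1) F a in simp_all)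
  have "card A \<le> q" unfolding A_def by (rule small[OF F(1,2) a])
  moreover have "q < card V" using V(2) q(2) by simp
  moreover have "2 * card V < 3 * (q + 1)"
  proof -
    have "2 * r \<le> q + 2" using q(1) by linarith
    then show ?thesis using V(2) by simp
  qed
  ultimately obtain y z where br: "bridge y z" and pair: 
    "\<forall>u\<in>V. \<forall>v\<in>V. comp (F - {{y, z}}) u \<noteq> comp (F - {{y, z}}) v
      \<longrightarrow> card (comp (F - {{y, z}}) u) + card (comp (F - {{y, z}}) v) \<le> q"
    using splitting_bridge[OF _ _ _ uv] by blast
  define D where "D = F - {{y, z}}"
  have D: "D \<subseteq> medges \<pi> V" using F(1) unfolding D_def by auto
  have yz: "y \<in> V" "z \<in> V" using br A_subset unfolding bridge_def by auto
  have ne: "comp D y \<noteq> comp D z"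
    using br comp_self[of z D] unfolding bridge_def D_def by auto
  have "card {comp D y, comp D z} \<le> card (comp D ` V)"
    using V(1) yz by (intro card_mono) auto
  then have two: "2 \<le> card (comp D ` V)" using ne by simp
  have "(\<Sum>B\<in>comp D ` V. msize \<pi> B) \<le> msize \<pi> (V - S)"
  proof (rule sum_msize_blocks_le[OF V partition_on_comp[OF D] two _ q S])
    fix B C assume "B \<in> comp D ` V" "C \<in> comp D ` V" "B \<noteq> C"
    then show "card B + card C \<le> q" using pair unfolding D_def by blast
  qed
  then have "card D \<le> msize \<pi> (V - S)"
    using card_le_sum_comp[OF D V(1)] by simp
  moreover have "card F = card D + 1"
    using br finite_subset[OF F(1)] V(1) card_Suc_Diff1[of F "{y, z}"]
    unfolding bridge_def D_def by simp
  moreover have "card (c ` medges \<pi> V) = card F"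
    using card_image[OF F(2)] F(3) by simp
  ultimately show ?thesis by simp
qed

section \<open>Trees and acyclic graphs\<close>

lemma simple_edge:
  assumes "simple_ugraph G" "{u, v} \<in> gedges G"
  shows "u \<in> gverts G" "v \<in> gverts G" "u \<noteq> v"
  using assms unfolding simple_ugraph_def by (fastforce, fastforce, fastforce)

lemma simple_edgeE:
  assumes "simple_ugraph G" "e \<in> gedges G"
  obtains u v where "e = {u, v}" "u \<in> gverts G" "v \<in> gverts G" "u \<noteq> v"
proof -
  have "card e = 2" using assms unfolding simple_ugraph_def by blast
  then obtain u v where uv: "e = {u, v}" by (meson card_2_iff)
  then show thesis using that simple_edge[of G u v] assms by simp
qed

lemma simple_finite_edges: "simple_ugraph G \<Longrightarrow> finite (gedges G)"
  unfolding simple_ugraph_def by (rule finite_subset[of _ "Pow (gverts G)"]) auto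

lemma walk_in_comp: "ugraph_walk G p \<Longrightarrow> last p \<in> comp (gedges G) (hd p)"
proof (induction p rule: rev_induct)
  case (snoc x p)
  show ?case
  proof (cases "p = []")
    case False
    then have "ugraph_walk G p" "{last p, x} \<in> gedges G"
      using snoc.prems unfolding ugraph_walk_def by (auto simp: successively_append_iff)
    then show ?thesis using snoc.IH comp_step False by fastforce
  qed simp
qed (simp add: ugraph_walk_def)

lemma comp_walk:
  assumes "simple_ugraph G" "u \<in> gverts G" "v \<in> comp (gedges G) u"
  shows "\<exists>p. ugraph_walk G p \<and> hd p = u \<and> last p = v"
proof -
  have "comp (gedges G) u \<subseteq> {v. \<exists>p. ugraph_walk G p \<and> hd p = u \<and> last p = v}"
  proof (rule comp_least)
    have "ugraph_walk G [u]" using assms(2) by (simp add: ugraph_walk_def)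
    then show "u \<in> {v. \<exists>p. ugraph_walk G p \<and> hd p = u \<and> last p = v}"
      by (intro CollectI exI[of _ "[u]"]) simp
  next
    fix x y assume "x \<in> {v. \<exists>p. ugraph_walk G p \<and> hd p = u \<and> last p = v}"
      and e: "{x, y} \<in> gedges G"
    then obtain p where p: "ugraph_walk G p" "hd p = u" "last p = x" by blast
    have "ugraph_walk G (p @ [y])"
      using p e simple_edge[OF assms(1) e] unfolding ugraph_walk_def
      by (auto simp: successively_append_iff)
    moreover have "p \<noteq> []" using p unfolding ugraph_walk_def by simp
    ultimately show "y \<in> {v. \<exists>p. ugraph_walk G p \<and> hd p = u \<and> last p = v}"
      using p by (intro CollectI exI[of _ "p @ [y]"]) simp
  qed
  then show ?thesis using assms(3) by blast
qed

lemma connected_ugraph_comp: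
  assumes "simple_ugraph G"
  shows "connected_ugraph G \<longleftrightarrow>
    gverts G \<noteq> {} \<and> (\<forall>u\<in>gverts G. gverts G \<subseteq> comp (gedges G) u)"
proof
  assume c: "connected_ugraph G"
  have "v \<in> comp (gedges G) u" if uv: "u \<in> gverts G" "v \<in> gverts G" for u v
  proof -
    obtain p where "ugraph_walk G p" "hd p = u" "last p = v"
      using c uv unfolding connected_ugraph_def by blast
    then show ?thesis using walk_in_comp[of G p] by simp
  qed
  then show "gverts G \<noteq> {} \<and> (\<forall>u\<in>gverts G. gverts G \<subseteq> comp (gedges G) u)"
    using c unfolding connected_ugraph_def by auto
next
  assume "gverts G \<noteq> {} \<and> (\<forall>u\<in>gverts G. gverts G \<subseteq> comp (gedges G) u)"
  then show "connected_ugraph G"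
    unfolding connected_ugraph_def using comp_walk[OF assms] by auto
qed

lemma cycle_two_neighbours:
  assumes "ugraph_cycle G p" "y \<in> set p"
  obtains a b where "a \<noteq> b" "{y, a} \<in> gedges G" "{y, b} \<in> gedges G"
proof -
  obtain as bs where p: "p = as @ y # bs" using assms(2) split_list by metis
  have len: "3 \<le> length p" and dist: "distinct p" and ends: "{last p, hd p} \<in> gedges G"
    and succ: "successively (\<lambda>u v. {u, v} \<in> gedges G) p"
    using assms(1) unfolding ugraph_cycle_def ugraph_walk_def by auto
  \<comment> \<open>The predecessor and successor of \<open>y\<close> in the cyclic order, wrapping
    around at the ends of the list; length at least 3 keeps them distinct.\<close>
  define a where "a = (if as = [] then last bs else last as)"
  define b where "b = (if bs = [] then hd as else hd bs)"
  have ne: "as \<noteq> [] \<or> bs \<noteq> []" using len p by auto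
  have "{a, y} \<in> gedges G"
    using succ ends ne unfolding p a_def by (auto simp: successively_append_iff)
  moreover have "{y, b} \<in> gedges G"
    using succ ends ne unfolding p b_def by (cases bs) (auto simp: successively_append_iff)
  moreover have "a \<noteq> b"
  proof (cases "as = []")
    case True
    then obtain z z' zs where "bs = z # z' # zs"
      using len p by (auto simp: Suc_le_length_iff numeral_3_eq_3)
    then show ?thesis using dist True unfolding p a_def b_def by auto
  next
    case as: False
    show ?thesis
    proof (cases "bs = []")
      case True
      then have "2 \<le> length as" using len p by simp
      then obtain z z' zs where "as = z # z' # zs"
        by (auto simp: Suc_le_length_iff numeral_2_eq_2)
      then show ?thesis using dist True unfolding p a_def b_def by auto
    next
      case False
      have "last as \<in> set as" "hd bs \<in> set bs" using as False by auto
      then have "last as \<noteq> hd bs" using dist unfolding p by auto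
      then show ?thesis using as False unfolding a_def b_def by simp
    qed
  qed
  ultimately show thesis using that by (simp add: insert_commute)
qed

text \<open>The new vertex has a single neighbour, so no cycle passes through it, and a cycle
  avoiding it already lies in \<open>T\<close>.\<close>

lemma tree_add_leaf:
  assumes T: "tree_ugraph T" and x: "x \<in> gverts T" and y: "y \<notin> gverts T"
  shows "tree_ugraph \<lparr>gverts = insert y (gverts T), gedges = insert {x, y} (gedges T)\<rparr>"
    (is "tree_ugraph ?T")
proof -
  have s: "simple_ugraph T" and c: "connected_ugraph T" and nc: "\<nexists>p. ugraph_cycle T p"
    using T unfolding tree_ugraph_def by auto
  have xy: "x \<noteq> y" using x y by auto
  have s': "simple_ugraph ?T" using s x xy unfolding simple_ugraph_def by auto
  have verts: "gverts T \<subseteq> comp (gedges ?T) x"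
    using c x comp_mono[of "gedges T" "gedges ?T" x] unfolding connected_ugraph_comp[OF s] by auto
  have "y \<in> comp (gedges ?T) x" by (rule comp_step[OF comp_self]) simp
  with verts have all: "gverts ?T \<subseteq> comp (gedges ?T) x" by simp
  have "gverts ?T \<subseteq> comp (gedges ?T) u" if "u \<in> gverts ?T" for u
    using all comp_eq[of u "gedges ?T" x] that by auto
  then have c': "connected_ugraph ?T" unfolding connected_ugraph_comp[OF s'] by simp
  have old: "y \<notin> e" if "e \<in> gedges T" for e
    using s y that unfolding simple_ugraph_def by blast
  have "\<not> ugraph_cycle ?T p" for p
  proof
    assume cyc: "ugraph_cycle ?T p"
    show False
    proof (cases "y \<in> set p")
      case True
      then obtain a b where "a \<noteq> b" "{y, a} \<in> gedges ?T" "{y, b} \<in> gedges ?T"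
        using cycle_two_neighbours[OF cyc] by blast
      then show False using old xy by (auto simp: doubleton_eq_iff)
    next
      case False
      have walk: "set p \<subseteq> gverts T" "p \<noteq> []"
        using cyc False unfolding ugraph_cycle_def ugraph_walk_def by auto
      have succ: "successively (\<lambda>u v. {u, v} \<in> gedges ?T) p" and "{last p, hd p} \<in> gedges ?T"
        using cyc unfolding ugraph_cycle_def ugraph_walk_def by auto
      moreover have "last p \<noteq> y" "hd p \<noteq> y" using False walk(2) by auto
      ultimately have ends: "{last p, hd p} \<in> gedges T" by (auto simp: doubleton_eq_iff)
      have "successively (\<lambda>u v. {u, v} \<in> gedges T) p"
        using succ by (rule successively_mono) (use False in \<open>auto simp: doubleton_eq_iff\<close>)
      then have "ugraph_cycle T p"
        using cyc walk ends unfolding ugraph_cycle_def ugraph_walk_def by simp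
      then show False using nc by blast
    qed
  qed
  then show ?thesis using s' c' unfolding tree_ugraph_def by blast
qed

text \<open>As long as the tree has fewer vertices than the component, some edge of \<open>F\<close>
  leaves its vertex set and can be attached as a leaf.\<close>

lemma tree_in_comp:
  assumes "finite (comp F v)" "Suc j \<le> card (comp F v)"
  shows "\<exists>T. tree_ugraph T \<and> v \<in> gverts T \<and> gverts T \<subseteq> comp F v \<and> card (gverts T) = Suc j
    \<and> gedges T \<subseteq> F \<and> card (gedges T) = j"
  using assms(2)
proof (induction j)
  case 0
  let ?T = "\<lparr>gverts = {v}, gedges = {}\<rparr>"
  have s: "simple_ugraph ?T" by (simp add: simple_ugraph_def)
  have "connected_ugraph ?T" unfolding connected_ugraph_comp[OF s] by simp
  moreover have "\<not> ugraph_cycle ?T p" for p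
    using cycle_two_neighbours[of ?T p "hd p"] by (auto simp: ugraph_cycle_def ugraph_walk_def)
  ultimately have "tree_ugraph ?T" using s unfolding tree_ugraph_def by blast
  then show ?case by (intro exI[of _ ?T]) simp
next
  case (Suc j)
  then obtain T where T: "tree_ugraph T" "v \<in> gverts T" "gverts T \<subseteq> comp F v"
    "card (gverts T) = Suc j" "gedges T \<subseteq> F" "card (gedges T) = j"
    by auto
  have s: "simple_ugraph T" using T(1) unfolding tree_ugraph_def by simp
  have fin: "finite (gverts T)" using s unfolding simple_ugraph_def by simp
  have "\<exists>x y. x \<in> gverts T \<and> y \<notin> gverts T \<and> {x, y} \<in> F"
  proof (rule ccontr)
    assume "\<nexists>x y. x \<in> gverts T \<and> y \<notin> gverts T \<and> {x, y} \<in> F"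
    then have "comp F v \<subseteq> gverts T" using T(2) by (intro comp_least) auto
    then have "card (comp F v) \<le> card (gverts T)" using fin by (rule card_mono[rotated])
    then show False using Suc.prems T(4) by simp
  qed
  then obtain x y where xy: "x \<in> gverts T" "y \<notin> gverts T" "{x, y} \<in> F" by blast
  let ?T = "\<lparr>gverts = insert y (gverts T), gedges = insert {x, y} (gedges T)\<rparr>"
  have "{x, y} \<notin> gedges T" using simple_edge[OF s] xy(2) by blast
  moreover have "y \<in> comp F v" using comp_step[of x F v y] T(3) xy by auto
  ultimately show ?case
    using T xy tree_add_leaf[OF T(1) xy(1,2)] fin simple_finite_edges[OF s]
    by (intro exI[of _ ?T]) simp
qed

section \<open>Isomorphic copies of trees\<close>

lemma ugraph_iso_sym:
  assumes "ugraph_iso G H"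
  shows "ugraph_iso H G"
proof -
  obtain f where f: "bij_betw f (gverts G) (gverts H)"
    and e: "\<And>u v. u \<in> gverts G \<Longrightarrow> v \<in> gverts G \<Longrightarrow> {u, v} \<in> gedges G \<longleftrightarrow> {f u, f v} \<in> gedges H"
    using assms unfolding ugraph_iso_def by blast
  let ?g = "inv_into (gverts G) f"
  have g: "bij_betw ?g (gverts H) (gverts G)" using f by (rule bij_betw_inv_into)
  have "{u, v} \<in> gedges H \<longleftrightarrow> {?g u, ?g v} \<in> gedges G" if "u \<in> gverts H" "v \<in> gverts H" for u v
    using e[of "?g u" "?g v"] that bij_betwE[OF g] bij_betw_inv_into_right[OF f] by simp
  then show ?thesis unfolding ugraph_iso_def using g by blast
qed

lemma ugraph_iso_edges:
  assumes "bij_betw f (gverts G) (gverts H)" "simple_ugraph G" "simple_ugraph H"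
    and "\<And>u v. u \<in> gverts G \<Longrightarrow> v \<in> gverts G \<Longrightarrow> {u, v} \<in> gedges G \<longleftrightarrow> {f u, f v} \<in> gedges H"
  shows "bij_betw ((`) f) (gedges G) (gedges H)"
proof (rule bij_betw_imageI)
  show "inj_on ((`) f) (gedges G)"
    using inj_on_image[of f "gedges G"] assms(1,2) unfolding bij_betw_def simple_ugraph_def
    by (meson Sup_le_iff inj_on_subset)
  show "(`) f ` gedges G = gedges H"
  proof (intro subset_antisym subsetI)
    fix e assume "e \<in> (`) f ` gedges G"
    then obtain e' where e': "e' \<in> gedges G" "e = f ` e'" by blast
    obtain u v where "e' = {u, v}" "u \<in> gverts G" "v \<in> gverts G"
      using simple_edgeE[OF assms(2) e'(1)] by blast
    then show "e \<in> gedges H" using e' assms(4) by simp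
  next
    fix e assume e: "e \<in> gedges H"
    obtain u v where uv: "e = {u, v}" "u \<in> gverts H" "v \<in> gverts H"
      using simple_edgeE[OF assms(3) e] by blast
    then obtain u' v' where "u = f u'" "v = f v'" "u' \<in> gverts G" "v' \<in> gverts G"
      using assms(1) unfolding bij_betw_def by blast
    then show "e \<in> (`) f ` gedges G"
      using e uv assms(4)[of u' v'] by (intro image_eqI[of _ _ "{u', v'}"]) auto
  qed
qed

lemma ugraph_iso_card_edges:
  assumes "ugraph_iso G H" "simple_ugraph G" "simple_ugraph H"
  shows "card (gedges G) = card (gedges H)"
  using assms ugraph_iso_edges bij_betw_same_card unfolding ugraph_iso_def by metis

lemma tree_iso:
  assumes "ugraph_iso G H" "tree_ugraph G" "simple_ugraph H"
  shows "tree_ugraph H"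
proof -
  have s: "simple_ugraph G" and c: "connected_ugraph G" and nc: "\<nexists>p. ugraph_cycle G p"
    using assms(2) unfolding tree_ugraph_def by auto
  obtain f where f: "bij_betw f (gverts G) (gverts H)"
    and e: "\<And>u v. u \<in> gverts G \<Longrightarrow> v \<in> gverts G \<Longrightarrow> {u, v} \<in> gedges G \<longleftrightarrow> {f u, f v} \<in> gedges H"
    using assms(1) unfolding ugraph_iso_def by blast
  let ?g = "inv_into (gverts G) f"
  have gf: "?g (f u) = u" if "u \<in> gverts G" for u
    using that bij_betw_inv_into_left[OF f] by simp
  have fg: "f (?g u) = u" "?g u \<in> gverts G" if "u \<in> gverts H" for u
    using that bij_betw_inv_into_right[OF f] bij_betwE[OF bij_betw_inv_into[OF f]] by simp_all
  have e': "{?g u, ?g v} \<in> gedges G" if "u \<in> gverts H" "v \<in> gverts H" "{u, v} \<in> gedges H" for u v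
    using e[of "?g u" "?g v"] fg that by simp
  have "connected_ugraph H"
    unfolding connected_ugraph_comp[OF assms(3)]
  proof (intro conjI ballI subsetI)
    show "gverts H \<noteq> {}" using c f unfolding connected_ugraph_def bij_betw_def by auto
    fix u v assume u: "u \<in> gverts H" and v: "v \<in> gverts H"
    have "comp (gedges G) (?g u) \<subseteq> {w \<in> gverts G. f w \<in> comp (gedges H) u}"
    proof (rule comp_least)
      fix x y assume x: "x \<in> {w \<in> gverts G. f w \<in> comp (gedges H) u}" and xy: "{x, y} \<in> gedges G"
      then have "y \<in> gverts G" "{f x, f y} \<in> gedges H"
        using simple_edge[OF s xy] e by auto
      then show "y \<in> {w \<in> gverts G. f w \<in> comp (gedges H) u}" using x comp_step by fastforce
    qed (simp add: fg u)
    moreover have "?g v \<in> comp (gedges G) (?g u)"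
      using c fg u v unfolding connected_ugraph_comp[OF s] by blast
    ultimately show "v \<in> comp (gedges H) u" using fg(1)[OF v] by auto
  qed
  moreover have "\<not> ugraph_cycle H p" for p
  proof
    assume cyc: "ugraph_cycle H p"
    then have p: "set p \<subseteq> gverts H" "p \<noteq> []" "distinct p" "3 \<le> length p"
      "{last p, hd p} \<in> gedges H" "successively (\<lambda>u v. {u, v} \<in> gedges H) p"
      unfolding ugraph_cycle_def ugraph_walk_def by auto
    have "successively (\<lambda>u v. {?g u, ?g v} \<in> gedges G) p"
      using p(6) by (rule successively_mono) (use p(1) e' in blast)
    moreover have "last p \<in> gverts H" "hd p \<in> gverts H" using p(1,2) by auto
    then have "{last (map ?g p), hd (map ?g p)} \<in> gedges G"
      using p(2,5) e'[of "last p" "hd p"] by (simp add: last_map hd_map)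
    moreover have "distinct (map ?g p)"
      using p(1,3) bij_betw_imp_inj_on[OF bij_betw_inv_into[OF f]]
      by (simp add: distinct_map inj_on_subset)
    moreover have "set (map ?g p) \<subseteq> gverts G" using p(1) fg by auto
    ultimately have "ugraph_cycle G (map ?g p)"
      using p(2,4) unfolding ugraph_cycle_def ugraph_walk_def by (simp add: successively_map)
    then show False using nc by blast
  qed
  ultimately show ?thesis using assms(3) unfolding tree_ugraph_def by blast
qed

lemma tree_nat_copy:
  assumes "tree_ugraph T"
  shows "\<exists>F\<in>trees_with_edges (card (gedges T)). ugraph_iso T F"
proof -
  have s: "simple_ugraph T" using assms unfolding tree_ugraph_def by simp
  have "finite (gverts T)" using s unfolding simple_ugraph_def by simp
  then obtain f :: "'a \<Rightarrow> nat" where f: "inj_on f (gverts T)"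
    using finite_imp_inj_to_nat_seg by metis
  define F where "F = \<lparr>gverts = f ` gverts T, gedges = (`) f ` gedges T\<rparr>"
  have bij: "bij_betw f (gverts T) (gverts F)" using f unfolding F_def bij_betw_def by simp
  have sub: "e \<subseteq> gverts T" "card e = 2" if "e \<in> gedges T" for e
    using that s unfolding simple_ugraph_def by auto
  have sF: "simple_ugraph F"
    unfolding simple_ugraph_def
  proof (intro conjI ballI)
    show "finite (gverts F)" using s unfolding F_def simple_ugraph_def by simp
    fix e assume "e \<in> gedges F"
    then obtain e' where e': "e' \<in> gedges T" "e = f ` e'" unfolding F_def by auto
    then show "e \<subseteq> gverts F" using sub[of e'] unfolding F_def by auto
    have "inj_on f e'" using f sub(1)[OF e'(1)] by (rule inj_on_subset)
    then show "card e = 2" using e' sub(2)[OF e'(1)] by (simp add: card_image)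
  qed
  have "{u, v} \<in> gedges T \<longleftrightarrow> {f u, f v} \<in> gedges F" if uv: "u \<in> gverts T" "v \<in> gverts T" for u v
  proof
    assume "{u, v} \<in> gedges T"
    then show "{f u, f v} \<in> gedges F" unfolding F_def by (auto intro: image_eqI[of _ _ "{u, v}"])
  next
    assume "{f u, f v} \<in> gedges F"
    then obtain e where e: "e \<in> gedges T" "f ` e = f ` {u, v}" unfolding F_def by auto
    then have "e = {u, v}"
      using inj_on_image_eq_iff[OF f sub(1)[OF e(1)], of "{u, v}"] uv by simp
    then show "{u, v} \<in> gedges T" using e by simp
  qed
  then have iso: "ugraph_iso T F" using bij unfolding ugraph_iso_def by blast
  then have "tree_ugraph F" using tree_iso assms sF by blast
  moreover have "card (gedges F) = card (gedges T)" using ugraph_iso_card_edges[OF iso s sF] by simp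
  ultimately show ?thesis using iso unfolding trees_with_edges_def by blast
qed

text \<open>All neighbours of the first vertex of a longest path lie on the path; one that is not
  the second vertex closes a cycle.\<close>

lemma cycle_of_min_degree_two:
  assumes s: "simple_ugraph G" and ne: "gverts G \<noteq> {}"
    and deg: "\<And>v. v \<in> gverts G \<Longrightarrow> \<exists>a b. a \<noteq> b \<and> {v, a} \<in> gedges G \<and> {v, b} \<in> gedges G"
  shows "\<exists>p. ugraph_cycle G p"
proof -
  have fin: "finite (gverts G)" using s unfolding simple_ugraph_def by simp
  let ?P = "\<lambda>p. ugraph_walk G p \<and> distinct p"
  obtain v\<^sub>0 where v\<^sub>0: "v\<^sub>0 \<in> gverts G" using ne by blast
  have 0: "?P [v\<^sub>0]" using v\<^sub>0 by (simp add: ugraph_walk_def)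
  have bound: "\<forall>p. ?P p \<longrightarrow> length p < Suc (card (gverts G))"
  proof (intro allI impI)
    fix p assume "?P p"
    then have "length p = card (set p)" "set p \<subseteq> gverts G"
      unfolding ugraph_walk_def by (auto simp: distinct_card)
    then show "length p < Suc (card (gverts G))" using card_mono[OF fin] by (simp add: less_Suc_eq_le)
  qed
  have "\<exists>p. ?P p \<and> (\<forall>p'. ?P p' \<longrightarrow> length p' \<le> length p)"
    by (rule ex_has_greatest_nat[of ?P "[v\<^sub>0]" length, OF 0 bound])
  then obtain p where p: "ugraph_walk G p" "distinct p"
    and max: "\<And>p'. ugraph_walk G p' \<Longrightarrow> distinct p' \<Longrightarrow> length p' \<le> length p" by blast
  obtain v ps where vps: "p = v # ps" using p(1) unfolding ugraph_walk_def by (cases p) auto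
  have v: "v \<in> gverts G" using p(1) unfolding vps ugraph_walk_def by simp
  have nb: "w \<in> set ps" if w: "{v, w} \<in> gedges G" for w
  proof (rule ccontr)
    assume "w \<notin> set ps"
    then have "distinct (w # p)" using p(2) simple_edge[OF s w] unfolding vps by auto
    moreover have "ugraph_walk G (w # p)"
      using p(1) w simple_edge[OF s w] unfolding vps ugraph_walk_def
      by (simp add: insert_commute)
    ultimately show False using max[of "w # p"] by simp
  qed
  obtain a b where ab: "a \<noteq> b" "{v, a} \<in> gedges G" "{v, b} \<in> gedges G" using deg[OF v] by blast
  obtain w where w: "{v, w} \<in> gedges G" "w \<noteq> hd ps"
    using ab by (cases "a = hd ps") auto
  obtain xs ys where ps: "ps = xs @ w # ys" using nb[OF w(1)] split_list by metis
  have xs: "xs \<noteq> []" using w(2) unfolding ps by (cases xs) auto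
  have p_prefix: "p = (v # xs @ [w]) @ ys" unfolding vps ps by simp
  have "ugraph_walk G (v # xs @ [w])"
    using p(1) unfolding p_prefix ugraph_walk_def
    unfolding successively_append_iff[of _ "v # xs @ [w]" ys] by simp
  moreover have "distinct (v # xs @ [w])" using p(2) unfolding vps ps by auto
  moreover have "3 \<le> length (v # xs @ [w])" using xs by (cases xs) auto
  ultimately have "ugraph_cycle G (v # xs @ [w])"
    using w(1) unfolding ugraph_cycle_def by (simp add: insert_commute)
  then show ?thesis by blast
qed

text \<open>An acyclic graph has a vertex of degree at most 1, and deleting it loses at most one
  edge. The purpose is that a tree with q edges has at least q + 1 vertices.\<close>

lemma acyclic_card_edges:
  assumes "simple_ugraph G" "gverts G \<noteq> {}" "\<nexists>p. ugraph_cycle G p"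
  shows "card (gedges G) < card (gverts G)"
  using assms
proof (induction "card (gverts G)" arbitrary: G rule: less_induct)
  case less
  note s = less.prems(1)
  have fin: "finite (gverts G)" using s unfolding simple_ugraph_def by simp
  have finE: "finite (gedges G)" using s by (rule simple_finite_edges)
  obtain v where v: "v \<in> gverts G"
    and leaf: "\<And>a b. {v, a} \<in> gedges G \<Longrightarrow> {v, b} \<in> gedges G \<Longrightarrow> a = b"
    using cycle_of_min_degree_two[OF s less.prems(2)] less.prems(3) by metis
  let ?E = "{e \<in> gedges G. v \<in> e}"
  have "e = e'" if e: "e \<in> ?E" "e' \<in> ?E" for e e'
  proof -
    obtain a where a: "e = {v, a}" using e(1) simple_edgeE[OF s, of e] by blast
    obtain b where b: "e' = {v, b}" using e(2) simple_edgeE[OF s, of e'] by blast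
    show ?thesis using leaf[of a b] e unfolding a b by simp
  qed
  then have E1: "card ?E \<le> 1"
    using finE by (simp add: card_le_Suc0_iff_eq)
  let ?G = "delete_vertex G v"
  have split: "card (gedges G) = card (gedges ?G) + card ?E"
  proof -
    have "gedges G = gedges ?G \<union> ?E" "gedges ?G \<inter> ?E = {}" unfolding delete_vertex_def by auto
    then show ?thesis using finE by (metis card_Un_disjoint finite_Un)
  qed
  have cardV: "card (gverts ?G) < card (gverts G)"
    using fin v unfolding delete_vertex_def using card_Diff1_less[of "gverts G" v] by simp
  show ?case
  proof (cases "gverts ?G = {}")
    case True
    then have "gverts G = {v}" using v unfolding delete_vertex_def by auto
    then have "gedges G = {}" using simple_edgeE[OF s] by (metis all_not_in_conv singletonD)
    then show ?thesis using v fin by (simp add: card_gt_0_iff) blast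
  next
    case False
    have s': "simple_ugraph ?G" using s unfolding simple_ugraph_def delete_vertex_def by auto
    have "\<not> ugraph_cycle ?G p" for p
    proof
      assume cyc: "ugraph_cycle ?G p"
      have "successively (\<lambda>u v. {u, v} \<in> gedges G) p"
        by (rule successively_mono[of "\<lambda>u v. {u, v} \<in> gedges ?G"])
          (use cyc in \<open>auto simp: ugraph_cycle_def ugraph_walk_def delete_vertex_def\<close>)
      then have "ugraph_cycle G p"
        using cyc unfolding ugraph_cycle_def ugraph_walk_def delete_vertex_def by auto
      then show False using less.prems(3) by blast
    qed
    then have "card (gedges ?G) < card (gverts ?G)" using less.hyps[OF cardV s' False] by blast
    then show ?thesis using split E1 cardV by linarith
  qed
qed

section \<open>Anti-Ramsey numbers\<close>

lemma complete_multipartite_mgraph: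
  assumes "complete_multipartite G P" "card P \<ge> 2"
  obtains \<pi> :: "'a \<Rightarrow> 'a set set" and u v where "G = mgraph \<pi> (gverts G)" "finite (gverts G)"
    "u \<in> gverts G" "v \<in> gverts G" "\<pi> u \<noteq> \<pi> v"
proof -
  \<comment> \<open>For a vertex this is the singleton of its part, a label obtained without a
    choice operator.\<close>
  define \<pi> where "\<pi> x = {X \<in> P. x \<in> X}" for x
  have part: "partition_on (gverts G) P" and fin: "finite (gverts G)"
    using assms(1) unfolding complete_multipartite_def simple_ugraph_def by auto
  have same: "(\<exists>X\<in>P. x \<in> X \<and> y \<in> X) \<longleftrightarrow> \<pi> x = \<pi> y" if "x \<in> gverts G" for x y
  proof
    assume "\<exists>X\<in>P. x \<in> X \<and> y \<in> X"
    then obtain X where X: "X \<in> P" "x \<in> X" "y \<in> X" by blast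
    have "Y = X" if "Y \<in> P" "x \<in> Y \<or> y \<in> Y" for Y
      using that X part unfolding partition_on_def disjoint_def by blast
    then show "\<pi> x = \<pi> y" using X unfolding \<pi>_def by blast
  next
    assume "\<pi> x = \<pi> y"
    moreover have "\<exists>X\<in>P. x \<in> X" using that part unfolding partition_on_def by blast
    ultimately show "\<exists>X\<in>P. x \<in> X \<and> y \<in> X" unfolding \<pi>_def by blast
  qed
  have "gedges G = {{x, y} | x y. x \<in> gverts G \<and> y \<in> gverts G \<and> \<not> (\<exists>X\<in>P. x \<in> X \<and> y \<in> X)}"
    using assms(1) unfolding complete_multipartite_def by blast
  also have "\<dots> = medges \<pi> (gverts G)" unfolding medges_def by (simp add: same cong: conj_cong)
  finally have G: "G = mgraph \<pi> (gverts G)" unfolding mgraph_def by simp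
  obtain X where X: "X \<in> P" using assms(2) by fastforce
  have "\<not> P \<subseteq> {X}" using assms(2) card_mono[of "{X}" P] by auto
  then obtain Y where Y: "Y \<in> P" "Y \<noteq> X" by blast
  obtain u where u: "u \<in> X" using X part unfolding partition_on_def by fastforce
  obtain v where v: "v \<in> Y" using Y part unfolding partition_on_def by fastforce
  have uv: "u \<in> gverts G" "v \<in> gverts G" using X Y u v part unfolding partition_on_def by blast+
  have "X \<notin> \<pi> v" using X Y v part unfolding \<pi>_def partition_on_def disjoint_def by blast
  moreover have "X \<in> \<pi> u" using X u unfolding \<pi>_def by simp
  ultimately have "\<pi> u \<noteq> \<pi> v" by blast
  then show thesis using that G fin uv by blast
qed

definition outer_coloring :: "('a \<Rightarrow> 'b) \<Rightarrow> 'a set \<Rightarrow> 'a set \<Rightarrow> ('a set \<Rightarrow> nat) \<Rightarrow> 'a set \<Rightarrow> nat" where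
  "outer_coloring \<pi> V S \<phi> e = (if e \<in> medges \<pi> (V - S) then \<phi> e else msize \<pi> (V - S) + 1)"

text \<open>All edges meeting \<open>S\<close> share a colour, so a rainbow tree has at most one such edge and hence
  cannot contain two vertices of \<open>S\<close>.\<close>

lemma no_rainbow_tree:
  assumes V: "finite V" and S: "S \<subseteq> V" "card (V - S) < q" and q: "2 \<le> q"
    and T: "tree_ugraph T" "card (gedges T) = q" "gverts T \<subseteq> V" "gedges T \<subseteq> medges \<pi> V"
  shows "\<not> inj_on (outer_coloring \<pi> V S \<phi>) (gedges T)"
proof
  assume rainbow: "inj_on (outer_coloring \<pi> V S \<phi>) (gedges T)"
  have s: "simple_ugraph T" and c: "connected_ugraph T" and nc: "\<nexists>p. ugraph_cycle T p"
    using T(1) unfolding tree_ugraph_def by auto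
  have ne: "gverts T \<noteq> {}" using c unfolding connected_ugraph_def by simp
  have finT: "finite (gverts T)" using s unfolding simple_ugraph_def by simp
  have verts: "q < card (gverts T)" using acyclic_card_edges[OF s ne nc] T(2) by simp
  have unique: "e = e'" if "e \<in> gedges T" "e' \<in> gedges T" "e \<inter> S \<noteq> {}" "e' \<inter> S \<noteq> {}" for e e'
  proof -
    have "outer_coloring \<pi> V S \<phi> e = outer_coloring \<pi> V S \<phi> e'"
      unfolding outer_coloring_def using that medges_Diff[of \<pi> V S] by auto
    then show ?thesis using rainbow that by (auto dest: inj_onD)
  qed
  have "card (gverts T) \<le> card (V - S) + card (gverts T \<inter> S)"
  proof -
    have "gverts T \<subseteq> (V - S) \<union> (gverts T \<inter> S)" using T(3) by auto
    then have "card (gverts T) \<le> card ((V - S) \<union> (gverts T \<inter> S))"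
      using V finT by (intro card_mono) auto
    then show ?thesis using card_Un_le le_trans by blast
  qed
  then have "2 \<le> card (gverts T \<inter> S)" using verts S(2) by linarith
  then obtain W where "W \<subseteq> gverts T \<inter> S" "card W = 2"
    by (rule obtain_subset_with_card_n)
  then obtain x y where xy: "x \<in> gverts T" "y \<in> gverts T" "x \<in> S" "y \<in> S" "x \<noteq> y"
    by (auto simp: card_2_iff)
  have edge: "\<exists>e\<in>gedges T. v \<in> e" if v: "v \<in> gverts T" for v
  proof (rule ccontr)
    assume "\<not> (\<exists>e\<in>gedges T. v \<in> e)"
    then have "comp (gedges T) v \<subseteq> {v}" by (intro comp_least) auto
    then have "gverts T \<subseteq> {v}" using c v unfolding connected_ugraph_comp[OF s] by blast
    then have "card (gverts T) \<le> 1" using card_mono[of "{v}" "gverts T"] by simp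
    then show False using verts q by linarith
  qed
  obtain e where e: "e \<in> gedges T" "x \<in> e" using edge xy(1) by blast
  obtain e' where e': "e' \<in> gedges T" "y \<in> e'" using edge xy(2) by blast
  have "e = e'" by (rule unique) (use e e' xy in auto)
  have exy: "e = {x, y}"
    using e e' \<open>e = e'\<close> xy(5) by (auto elim!: simple_edgeE[OF s])
  \<comment> \<open>Any edge at \<open>x\<close> or \<open>y\<close> meets \<open>S\<close>, hence
    equals \<open>e\<close>; so \<open>T\<close> would consist of \<open>e\<close> alone, while it
    has more than q \<ge> 2 vertices.\<close>
  have "comp (gedges T) x \<subseteq> {x, y}"
  proof (rule comp_least)
    fix u w assume "u \<in> {x, y}" "{u, w} \<in> gedges T"
    then have "{u, w} = e" by (intro unique e(1)) (use e xy in auto)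
    then show "w \<in> {x, y}" using exy by blast
  qed simp
  then have "gverts T \<subseteq> {x, y}" using c xy(1) unfolding connected_ugraph_comp[OF s] by blast
  then have "card (gverts T) \<le> 2" using card_mono[of "{x, y}" "gverts T"] xy(5) by simp
  then show False using verts q by linarith
qed

lemma outer_coloring_edge_coloring:
  assumes V: "finite V" and S: "S \<subseteq> V" "S \<noteq> {}"
    and uv: "u \<in> V" "v \<in> V" "\<pi> u \<noteq> \<pi> v"
    and \<phi>: "bij_betw \<phi> (medges \<pi> (V - S)) {1..msize \<pi> (V - S)}"
  shows "outer_coloring \<pi> V S \<phi> ` medges \<pi> V = {1..msize \<pi> (V - S) + 1}"
proof -
  let ?I = "medges \<pi> (V - S)" and ?c = "outer_coloring \<pi> V S \<phi>"
  obtain x where x: "x \<in> S" using S(2) by blast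
  \<comment> \<open>The last colour is used only if some edge meets \<open>S\<close>; with two
    labels present every vertex has a neighbour.\<close>
  obtain w where w: "w \<in> V" "\<pi> w \<noteq> \<pi> x" using uv by metis
  have xw: "{x, w} \<in> medges \<pi> V" "{x, w} \<notin> ?I" using x w S(1) by auto
  have "medges \<pi> V = ?I \<union> (medges \<pi> V - ?I)" using medges_mono[of "V - S" V \<pi>] by auto
  then have "?c ` medges \<pi> V = ?c ` ?I \<union> ?c ` (medges \<pi> V - ?I)" by (metis image_Un)
  also have "?c ` ?I = \<phi> ` ?I" by (rule image_cong) (simp_all add: outer_coloring_def)
  also have "\<phi> ` ?I = {1..msize \<pi> (V - S)}" using \<phi> unfolding bij_betw_def by simp
  also have "?c ` (medges \<pi> V - ?I) = {msize \<pi> (V - S) + 1}"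
  proof -
    have "medges \<pi> V - ?I \<noteq> {}" using xw by blast
    moreover have "?c ` (medges \<pi> V - ?I) = (\<lambda>_. msize \<pi> (V - S) + 1) ` (medges \<pi> V - ?I)"
      by (rule image_cong) (simp_all add: outer_coloring_def)
    ultimately show ?thesis by (simp only: image_constant_conv if_False)
  qed
  finally show ?thesis by auto
qed

lemma sub_ugraph_mgraph_iso_tree:
  assumes "sub_ugraph H (mgraph \<pi> V)" "F \<in> trees_with_edges q" "ugraph_iso H F"
  shows "tree_ugraph H" "card (gedges H) = q" "gverts H \<subseteq> V" "gedges H \<subseteq> medges \<pi> V"
proof -
  have H: "simple_ugraph H" "gverts H \<subseteq> V" "gedges H \<subseteq> medges \<pi> V"
    using assms(1) unfolding sub_ugraph_def by auto
  have F: "tree_ugraph F" "card (gedges F) = q"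
    using assms(2) unfolding trees_with_edges_def by auto
  show "tree_ugraph H" using tree_iso[OF ugraph_iso_sym[OF assms(3)] F(1) H(1)] .
  show "card (gedges H) = q"
    using ugraph_iso_card_edges[OF assms(3) H(1)] F unfolding tree_ugraph_def by simp
  show "gverts H \<subseteq> V" "gedges H \<subseteq> medges \<pi> V" by (fact H)+
qed

lemma small_components_of_no_rainbow_tree:
  assumes V: "finite V"
    and none: "\<not> (\<exists>H. sub_ugraph H (mgraph \<pi> V) \<and> rainbow c H \<and> (\<exists>F\<in>trees_with_edges q. ugraph_iso H F))"
    and F: "F \<subseteq> medges \<pi> V" "inj_on c F" and v: "v \<in> V"
  shows "card (comp F v) \<le> q"
proof (rule ccontr)
  assume "\<not> card (comp F v) \<le> q"
  moreover have sub: "comp F v \<subseteq> V" using F(1) v by (rule comp_subset)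
  ultimately obtain T where T: "tree_ugraph T" "gverts T \<subseteq> comp F v" "gedges T \<subseteq> F" "card (gedges T) = q"
    using tree_in_comp[of F v q] V finite_subset[of "comp F v" V] by auto
  have "sub_ugraph T (mgraph \<pi> V)"
    using T sub F(1) unfolding sub_ugraph_def tree_ugraph_def by auto
  moreover have "rainbow c T" using F(2) T(3) unfolding rainbow_def by (rule inj_on_subset)
  moreover have "\<exists>F\<in>trees_with_edges q. ugraph_iso T F" using tree_nat_copy[OF T(1)] T(4) by simp
  ultimately show False using none by blast
qed

lemma anti_ramsey_mgraph:
  fixes \<pi> :: "'a \<Rightarrow> 'b"
  assumes V: "finite V" "card V = q + r" and q: "4 * r \<le> q + 2" "1 \<le> r"
    and uv: "u \<in> V" "v \<in> V" "\<pi> u \<noteq> \<pi> v"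
    and S: "S \<in> greedy_min_degree_sets (Suc r) (mgraph \<pi> V)"
  shows "ar (mgraph \<pi> V) (trees_with_edges q) = msize \<pi> (V - S) + 1"
proof -
  let ?A = "anti_ramsey_colors (mgraph \<pi> V) (trees_with_edges q)"
  have SV: "S \<subseteq> V" "card S = Suc r" using greedy_mgraph_subset[OF S V(1)] by auto
  have finS: "finite S" and "S \<noteq> {}" using SV V(1) finite_subset by auto
  have upper: "t \<le> msize \<pi> (V - S) + 1" if "t \<in> ?A" for t
  proof -
    obtain c where c: "edge_coloring (mgraph \<pi> V) t c"
      and none: "\<not> (\<exists>H. sub_ugraph H (mgraph \<pi> V) \<and> rainbow c H \<and> (\<exists>F\<in>trees_with_edges q. ugraph_iso H F))"
      using \<open>t \<in> ?A\<close> unfolding anti_ramsey_colors_def by blast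
    have "card (c ` medges \<pi> V) \<le> msize \<pi> (V - S) + 1"
      by (rule colors_le_of_small_components[OF V q uv _ S])
        (rule small_components_of_no_rainbow_tree[OF V(1) none])
    moreover have "c ` medges \<pi> V = {1..t}" using c unfolding edge_coloring_def by simp
    ultimately show ?thesis by simp
  qed
  obtain \<phi> where \<phi>: "bij_betw \<phi> (medges \<pi> (V - S)) {1..msize \<pi> (V - S)}"
    using ex_bij_betw_nat_finite_1[of "medges \<pi> (V - S)"] V(1) bij_betw_inv by (metis finite_Diff finite_medges)
  \<comment> \<open>Deleting r + 1 of the q + r vertices leaves q - 1, one fewer than q.\<close>
  have "card (V - S) < q"
    using SV finS V(2) q by (simp add: card_Diff_subset)
  moreover have "2 \<le> q" using q by linarith
  ultimately have "\<not> (\<exists>H. sub_ugraph H (mgraph \<pi> V) \<and> rainbow (outer_coloring \<pi> V S \<phi>) H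
      \<and> (\<exists>F\<in>trees_with_edges q. ugraph_iso H F))"
    using no_rainbow_tree[OF V(1) SV(1)] sub_ugraph_mgraph_iso_tree unfolding rainbow_def by metis
  moreover have "edge_coloring (mgraph \<pi> V) (msize \<pi> (V - S) + 1) (outer_coloring \<pi> V S \<phi>)"
    unfolding edge_coloring_def
    using outer_coloring_edge_coloring[OF V(1) SV(1) \<open>S \<noteq> {}\<close> uv \<phi>] by simp
  ultimately have lower: "msize \<pi> (V - S) + 1 \<in> ?A"
    unfolding anti_ramsey_colors_def by blast
  have "finite ?A" using upper by (meson finite_nat_set_iff_bounded_le)
  then have "Max ?A = msize \<pi> (V - S) + 1" using lower upper by (intro Max_eqI)
  then show ?thesis using lower unfolding ar_def by auto
qed

theorem theorem7p2:
  fixes G :: "'a ugraph" and P :: "'a set set" and n q :: nat and S\<^sub>0 :: "'a set"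
  assumes "complete_multipartite G P"
    and "card P \<ge> 2"
    and "card (gverts G) = n"
    and "(4 * real n - 2) / 5 \<le> real q"
    and "real q \<le> real n - 1"
    and "S\<^sub>0 \<in> greedy_min_degree_sets (n - q + 1) G"
  shows "int (ar G (trees_with_edges q)) =
         int (card (gedges G)) + 1 - int (card (incident_edges G S\<^sub>0))"
proof -
  obtain \<pi> :: "'a \<Rightarrow> 'a set set" and u v where G: "G = mgraph \<pi> (gverts G)"
    and fin: "finite (gverts G)" and uv: "u \<in> gverts G" "v \<in> gverts G" "\<pi> u \<noteq> \<pi> v"
    using complete_multipartite_mgraph[OF assms(1,2)] by metis
  define V where "V = gverts G"
  define r where "r = n - q"
  have GV: "G = mgraph \<pi> V" using G unfolding V_def .
  have "q + 1 \<le> n" using assms(5) by linarith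
  then have n: "card V = q + r" "1 \<le> r" using assms(3) unfolding r_def V_def by auto
  have "4 * real n - 2 \<le> 5 * real q" using assms(4) by simp
  then have "real (4 * n) \<le> real (5 * q + 2)" by simp
  then have "4 * n \<le> 5 * q + 2" by (rule of_nat_le_iff[THEN iffD1])
  then have q: "4 * r \<le> q + 2" using n(1) assms(3) unfolding V_def by simp
  have S: "S\<^sub>0 \<in> greedy_min_degree_sets (Suc r) (mgraph \<pi> V)"
    using assms(6) GV unfolding r_def by simp
  have ar: "ar G (trees_with_edges q) = msize \<pi> (V - S\<^sub>0) + 1"
    unfolding GV by (rule anti_ramsey_mgraph[OF _ n(1) q n(2) _ _ _ S]) (use fin uv V_def in auto)
  \<comment> \<open>The edges avoiding \<open>S\<^sub>0\<close> and those meeting it partition the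
    edge set, which turns the count of the remaining graph into the stated difference.\<close>
  have "medges \<pi> V = medges \<pi> (V - S\<^sub>0) \<union> incident_edges G S\<^sub>0"
    "medges \<pi> (V - S\<^sub>0) \<inter> incident_edges G S\<^sub>0 = {}"
    unfolding incident_edges_def medges_Diff GV by auto
  then have "msize \<pi> V = msize \<pi> (V - S\<^sub>0) + card (incident_edges G S\<^sub>0)"
    using fin finite_medges[of V \<pi>] unfolding V_def[symmetric] by (metis card_Un_disjoint finite_Un)
  moreover have "gedges G = medges \<pi> V" using GV by simp
  ultimately show ?thesis using ar by simp
qed

end
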